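(* Let $\Omega$ be a Polish metric space, $d\ge1$, $\mathfrak{a}\colon\Omega\to\mathbb{T}^d$ a continuous function, $X=\Omega^{\mathbb{Z}}$, and let $f\colon X\times\mathbb{T}^d\to X\times\mathbb{T}^d$, $f(\omega,\theta)=(\sigma\omega,\theta+\mathfrak{a}(\omega_0))$. Let $m$ be the Haar probability measure on $\mathbb{T}^d$. Let $\nu_0\in\mathrm{Prob}_c(\Omega)$ be such that $f$ is ergodic with respect to $\nu_0^{\mathbb{Z}}\times m$, and let $\phi\in C_b(X\times\mathbb{T}^d)$ be an observable that depends on a finite number of coordinates of $\omega\in X$ (and on $\theta$). Given any $\epsilon>0$, there are $\delta=\delta(\epsilon,\nu_0,\phi)>0$, $\bar n=\bar n(\epsilon,\nu_0,\phi)\in\mathbb{N}$ and $c=c(\epsilon,\nu_0,\phi)>0$ such that for all $\nu\in\mathrm{Prob}_c(\Omega)$ with $W_1(\nu,\nu_0)<\delta$, for all $\theta\in\mathbb{T}^d$ and for all $n\ge\bar n$ we have $$\nu^{\mathbb{Z}}\left\{\omega\in X\colon\left|\frac1n\sum_{j=0}^{n-1}\phi(f^j(\omega,\theta))-\int_{X\times\mathbb{T}^d}\phi\,d(\nu^{\mathbb{Z}}\times m)\right|\ge\epsilon\right\}<e^{-cn}.$$ A similar estimate also holds with the integral taken with respect to the fixed measure $\nu_0^{\mathbb{Z}}\times m$ instead of $\nu^{\mathbb{Z}}\times m$; that is, for every $\epsilon>0$ there are $\delta>0$, $\bar n\in\mathbb{N}$ and $c>0$, depending only on $\epsilon,\nu_0,\phi$,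 such that for all $\nu\in\mathrm{Prob}_c(\Omega)$ with $W_1(\nu,\nu_0)<\delta$, all $\theta\in\mathbb{T}^d$ and all $n\ge\bar n$, $$\nu^{\mathbb{Z}}\left\{\omega\in X\colon\left|\frac1n\sum_{j=0}^{n-1}\phi(f^j(\omega,\theta))-\int_{X\times\mathbb{T}^d}\phi\,d(\nu_0^{\mathbb{Z}}\times m)\right|\ge\epsilon\right\}<e^{-cn}.$$
   Context: $\mathbb{T}^d=(\mathbb{R}/\mathbb{Z})^d$. $\sigma$ is the left shift on $X=\Omega^{\mathbb{Z}}$, $(\sigma\omega)_n=\omega_{n+1}$ for $\omega=\{\omega_n\}_{n\in\mathbb{Z}}$, and $X$ carries the product topology. $\mathrm{Prob}_c(\Omega)$ is the set of compactly supported Borel probability measures on $\Omega$; for $\nu\in\mathrm{Prob}_c(\Omega)$, $\nu^{\mathbb{Z}}$ is the product measure on $X$, and $f$ preserves $\nu^{\mathbb{Z}}\times m$. $C_b(X\times\mathbb{T}^d)$ is the space of bounded continuous real-valued functions on $X\times\mathbb{T}^d$. Wasserstein distance: with $\Omega$ equipped with its metric, for $\nu,\nu'\in\mathrm{Prob}_c(\Omega)$, $$W_1(\nu,\nu'):=\sup\left\{\int g\,d(\nu-\nu')\colon g\colon\Omega\to\mathbb{R}\text{ Lipschitz with Lipschitz constant at most }1\right\}.$$ *)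

theory Defs
  imports "HOL-Probability.Probability"
begin

quotient_type circle = real / "\<lambda>x y. x - y \<in> \<int>"
  morphisms rep_circle circle_of
proof (rule equivpI)
  show "reflp (\<lambda>x y::real. x - y \<in> \<int>)"
    by (simp add: reflp_def)
  show "symp (\<lambda>x y::real. x - y \<in> \<int>)"
    by (metis (no_types, lifting) Ints_minus minus_diff_eq sympI)
  show "transp (\<lambda>x y::real. x - y \<in> \<int>)"
    by (rule transpI) (metis (no_types, lifting) Ints_add diff_add_cancel add_diff_eq)
qed

instantiation circle :: ab_group_add
begin

lift_definition zero_circle :: circle is "0 :: real" .

lift_definition plus_circle :: "circle \<Rightarrow> circle \<Rightarrow> circle" is "(+) :: real \<Rightarrow> real \<Rightarrow> real"
  by (metis (no_types, lifting) Ints_add add_diff_add)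

lift_definition uminus_circle :: "circle \<Rightarrow> circle" is "uminus :: real \<Rightarrow> real"
  by (metis (no_types, lifting) Ints_minus minus_diff_minus)

lift_definition minus_circle :: "circle \<Rightarrow> circle \<Rightarrow> circle" is "(-) :: real \<Rightarrow> real \<Rightarrow> real"
proof -
  fix a b c d :: real
  assume "a - b \<in> \<int>" "c - d \<in> \<int>"
  then have "(a - b) - (c - d) \<in> \<int>" by (rule Ints_diff)
  then show "(a - c) - (b - d) \<in> \<int>" by (simp add: algebra_simps)
qed

instance
  by standard (transfer, simp add: algebra_simps)+

end

instantiation circle :: topological_space
begin

definition open_circle :: "circle set \<Rightarrow> bool"
  where "open_circle U \<longleftrightarrow> open (circle_of -` U)"

instance
proof
  show "open (UNIV :: circle set)"
    by (simp add: open_circle_def)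
  show "open (S \<inter> T)" if "open S" "open T" for S T :: "circle set"
    using that by (auto simp: open_circle_def)
  show "open (\<Union> K)" if "\<forall>S\<in>K. open S" for K :: "circle set set"
    using that by (auto simp: open_circle_def vimage_Union)
qed

end

text \<open>The torus is \<^typ>\<open>circle ^ 'd\<close>, with the product topology and componentwise
  addition; the dimension is \<^term>\<open>CARD('d)\<close>, which is at least 1.\<close>

definition haar_prob :: "('g :: {topological_space, ab_group_add}) measure \<Rightarrow> bool"
  where "haar_prob m \<longleftrightarrow>
    prob_space m \<and> sets m = sets borel \<and> (\<forall>g. distr m m (\<lambda>x. g + x) = m)"

definition measure_support :: "('a :: topological_space) measure \<Rightarrow> 'a set"
  where "measure_support \<nu> = {x. \<forall>U. open U \<and> x \<in> U \<longrightarrow> emeasure \<nu> U > 0}"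

definition Prob_c :: "('a :: topological_space) measure set"
  where "Prob_c =
    {\<nu>. prob_space \<nu> \<and> sets \<nu> = sets borel \<and> compact (measure_support \<nu>)}"

text \<open>On \<^const>\<open>Prob_c\<close> (over a Polish space) each \<open>g\<close> below is integrable and the set of
  differences is bounded, so the real-valued supremum and the integrals are the genuine ones.\<close>

definition W1 :: "('a :: metric_space) measure \<Rightarrow> 'a measure \<Rightarrow> real"
  where "W1 \<nu> \<nu>' =
    (SUP g \<in> {g :: 'a \<Rightarrow> real. 1-lipschitz_on UNIV g}. (\<integral>x. g x \<partial>\<nu>) - (\<integral>x. g x \<partial>\<nu>'))"

definition shift :: "(int \<Rightarrow> 'a) \<Rightarrow> (int \<Rightarrow> 'a)"
  where "shift \<omega> = (\<lambda>n. \<omega> (n + 1))"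

definition skew :: "('a \<Rightarrow> circle ^ 'd) \<Rightarrow> (int \<Rightarrow> 'a) \<times> (circle ^ 'd) \<Rightarrow> (int \<Rightarrow> 'a) \<times> (circle ^ 'd)"
  where "skew \<aa> = (\<lambda>(\<omega>, \<theta>). (shift \<omega>, \<theta> + \<aa> (\<omega> 0)))"

definition bernoulli :: "'a measure \<Rightarrow> (int \<Rightarrow> 'a) measure"
  where "bernoulli \<nu> = Pi\<^sub>M UNIV (\<lambda>_. \<nu>)"

definition ergodic :: "'x measure \<Rightarrow> ('x \<Rightarrow> 'x) \<Rightarrow> bool"
  where "ergodic M T \<longleftrightarrow>
    T \<in> measurable M M \<and> distr M M T = M \<and>
    (\<forall>A \<in> sets M. T -` A \<inter> space M = A \<longrightarrow> measure M A = 0 \<or> measure M A = 1)"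

definition C_b :: "('x :: topological_space \<Rightarrow> real) set"
  where "C_b = {\<phi>. continuous_on UNIV \<phi> \<and> bounded (range \<phi>)}"

definition depends_on_finitely_many_coords :: "((int \<Rightarrow> 'a) \<times> 't \<Rightarrow> 'b) \<Rightarrow> bool"
  where "depends_on_finitely_many_coords \<phi> \<longleftrightarrow>
    (\<exists>J. finite J \<and> (\<forall>\<omega> \<omega>' \<theta>. (\<forall>i\<in>J. \<omega> i = \<omega>' i) \<longrightarrow> \<phi> (\<omega>, \<theta>) = \<phi> (\<omega>', \<theta>)))"

definition birkhoff_average :: "('x \<Rightarrow> 'x) \<Rightarrow> ('x \<Rightarrow> real) \<Rightarrow> nat \<Rightarrow> 'x \<Rightarrow> real"
  where "birkhoff_average T \<phi> n x = (1 / real n) * (\<Sum>j<n. \<phi> ((T ^^ j) x))"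

end

theory Submission
  imports Defs
begin

text \<open>
  The Birkhoff sums are compared with those of long blocks of independent coordinates, on which an
  exponential Chebyshev inequality can be iterated.

  An observable \<open>\<phi>\<close> that depends on the coordinates from \<open>-k\<close> to \<open>k\<close> becomes, after \<open>k\<close> steps of
  the skew product, an observable \<open>\<psi>\<close> of the coordinates below \<open>p = 2k + 1\<close> of a one-sided sequence.
  A block of \<open>N + p\<close> time steps, of which the last \<open>p\<close> are discarded, then involves a starting angle
  and \<open>N + p\<close> fresh coordinates only. If the expected average of \<open>\<psi>\<close> over a block is close to a
  constant \<open>I\<close> \<^emph>\<open>for every starting angle\<close>, then conditioning on the past bounds the exponential
  moment of the sum over \<open>q\<close> blocks by the \<open>q\<close>-th power of a bound for one block
  (\<open>exp_moment_blocks\<close>), and Chernoff's argument gives the exponential estimate with constants that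
  depend only on \<open>N\<close>, \<open>p\<close>, the bound of \<open>\<psi>\<close> and the tolerance (\<open>large_deviation_upper\<close>).

  It remains to control the expected block averages uniformly in the angle and in all \<open>\<nu>\<close> close to
  \<open>\<nu>\<^sub>0\<close>. For a function \<open>\<Prod>i<p. g i (x i)\<close> times a character \<open>\<kappa>\<close> of the torus, the expectation after
  \<open>j\<close> steps is explicit: it is a product of integrals with respect to \<open>\<nu>\<close>, times the \<open>j\<close>-th power of
  \<open>w = \<integral>x. \<kappa> (a x) \<partial>\<nu>\<close>, times \<open>\<kappa> \<theta>\<close>. Ergodicity for \<open>\<nu>\<^sub>0\<close> implies that \<open>w \<noteq> 1\<close> for
  every nontrivial \<open>\<kappa>\<close> (\<open>ergodic_imp_integral_character_neq_1\<close>), so the averages of these powers tend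
  to \<open>0\<close> for \<open>\<nu>\<^sub>0\<close>; for a fixed block length all the integrals depend continuously on \<open>\<nu>\<close> in the
  Wasserstein distance (\<open>tendsto_integral_W1_nhds\<close>), and \<open>\<kappa> \<theta>\<close> has modulus one. Hence block averages
  of such functions are close to a constant, uniformly in the angle (\<open>trig_block_average\<close>).

  By the Stone-Weierstrass theorem, \<open>\<psi>\<close> is approximated by sums of such functions for sequences whose
  first \<open>p\<close> entries lie in a neighbourhood of the compact support of \<open>\<nu>\<^sub>0\<close>
  (\<open>trig_approximation\<close>); measures close to \<open>\<nu>\<^sub>0\<close> give little mass to the complement of that
  neighbourhood. This transfers the statement about block averages to \<open>\<psi>\<close>
  (\<open>block_average_near_constant\<close>).

  Finally, the product of the Bernoulli and the Haar measure is invariant, so the space average for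
  \<open>\<nu>\<close> is the Haar average of the block averages over the angle, and therefore close to the same
  constant. The space average for \<open>\<nu>\<^sub>0\<close> is the special case \<open>\<nu> = \<nu>\<^sub>0\<close>, so both versions of the
  theorem follow from one estimate.
\<close>

section \<open>The torus as a compact topological group\<close>

lemma continuous_circle_of: "continuous_on UNIV circle_of"
  by (simp add: continuous_on_open_vimage open_circle_def)

lemma circle_of_eq_iff: "circle_of x = circle_of y \<longleftrightarrow> x - y \<in> \<int>"
  by (rule circle.abs_eq_iff)

lemma surj_circle_of: "surj circle_of"
  by (metis surjI Quotient_circle Quotient_abs_rep)

lemma open_circle_of_image:
  assumes "open U" shows "open (circle_of ` U)"
proof -
  have "circle_of -` circle_of ` U = (\<Union>k\<in>\<int>. (\<lambda>x. k + x) ` U)"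
  proof (intro set_eqI iffI)
    fix x assume "x \<in> circle_of -` circle_of ` U"
    then obtain y where "y \<in> U" "x - y \<in> \<int>" by (auto simp: circle_of_eq_iff)
    then show "x \<in> (\<Union>k\<in>\<int>. (\<lambda>x. k + x) ` U)"
      by (intro UN_I[of "x - y"] image_eqI[of _ _ y]) auto
  next
    fix x assume "x \<in> (\<Union>k\<in>\<int>. (\<lambda>x. k + x) ` U)"
    then obtain k y where "k \<in> \<int>" "y \<in> U" "x = k + y" by auto
    then show "x \<in> circle_of -` circle_of ` U"
      by (auto simp: circle_of_eq_iff intro!: image_eqI[of _ _ y])
  qed
  moreover have "open \<dots>"
    using assms by (intro open_UN ballI open_translation)
  ultimately show ?thesis by (simp add: open_circle_def)
qed

lemma tendsto_circle_of: "(circle_of \<longlongrightarrow> circle_of x) (nhds x)"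
  using continuous_circle_of
  by (metis UNIV_I continuous_on_eq_continuous_at isCont_def open_UNIV tendsto_at_iff_tendsto_nhds)

text \<open>The projection is continuous and open, so convergence in the circle can be checked by lifting to the
  line; this turns continuity of the group operations into that of the real ones.\<close>

lemma nhds_circle_of: "nhds (circle_of x) = filtermap circle_of (nhds x)"
proof (rule filter_eqI)
  fix P
  show "eventually P (nhds (circle_of x)) \<longleftrightarrow> eventually P (filtermap circle_of (nhds x))"
  proof
    assume "eventually P (nhds (circle_of x))"
    then show "eventually P (filtermap circle_of (nhds x))"
      using tendsto_circle_of[of x] by (simp add: eventually_filtermap filterlim_iff)
  next
    assume "eventually P (filtermap circle_of (nhds x))"
    then obtain U where "open U" "x \<in> U" "\<forall>y\<in>U. P (circle_of y)"
      by (auto simp: eventually_filtermap eventually_nhds)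
    then show "eventually P (nhds (circle_of x))"
      unfolding eventually_nhds by (intro exI[of _ "circle_of ` U"]) (auto intro: open_circle_of_image)
  qed
qed

instance circle :: topological_ab_group_add
proof
  fix a b :: circle
  obtain x y where ab: "a = circle_of x" "b = circle_of y"
    using surj_circle_of by (metis surj_def)
  have "((\<lambda>p. circle_of (fst p + snd p)) \<longlongrightarrow> circle_of (x + y)) (nhds x \<times>\<^sub>F nhds y)"
    by (rule filterlim_compose[OF tendsto_circle_of tendsto_add_Pair])
  then show "LIM p (nhds a \<times>\<^sub>F nhds b). fst p + snd p :> nhds (a + b)"
    unfolding ab plus_circle.abs_eq nhds_circle_of[of x] nhds_circle_of[of y] prod_filtermap1 prod_filtermap2
    by (simp add: filterlim_filtermap split_def plus_circle.abs_eq)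
  have "((\<lambda>x. circle_of (- x)) \<longlongrightarrow> circle_of (- x)) (nhds x)"
    by (rule filterlim_compose[OF tendsto_circle_of tendsto_uminus_nhds])
  then show "(uminus \<longlongrightarrow> - a) (nhds a)"
    unfolding ab uminus_circle.abs_eq nhds_circle_of[of x]
    by (simp add: filterlim_filtermap uminus_circle.abs_eq)
qed

instance circle :: second_countable_topology
proof
  obtain B :: "real set set" where B: "countable B" "topological_basis B"
    using ex_countable_basis by blast
  have "topological_basis ((`) circle_of ` B)"
  proof (rule topological_basisI)
    fix U :: "circle set" and a assume U: "open U" "a \<in> U"
    obtain x where x: "a = circle_of x" using surj_circle_of by (metis surj_def)
    have "open (circle_of -` U)" using U by (simp add: open_circle_def)
    then obtain V where "V \<in> B" "x \<in> V" "V \<subseteq> circle_of -` U"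
      using topological_basisE[OF B(2), of "circle_of -` U" x] U x by blast
    then show "\<exists>W\<in>(`) circle_of ` B. a \<in> W \<and> W \<subseteq> U"
      using x by (intro bexI[of _ "circle_of ` V"]) auto
  qed (use B(2) in \<open>auto intro!: open_circle_of_image topological_basis_open\<close>)
  then show "\<exists>B::circle set set. countable B \<and> open = generate_topology B"
    using B(1) by (metis countable_image topological_basis_imp_subbasis)
qed

text \<open>The character that identifies the circle with the unit circle of the complex plane. As it is
  continuous and injective, it shows that the circle is Hausdorff, and its pullbacks along the
  coordinates are enough characters of the torus for the Stone-Weierstrass theorem.\<close>

lift_definition circle_char :: "circle \<Rightarrow> complex" is "\<lambda>x. cis (2 * pi * x)"
proof -
  fix x y :: real assume "x - y \<in> \<int>"
  then obtain k :: int where "x = y + k" by (metis Ints_cases add.commute diff_add_cancel)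
  then have "cis (2 * pi * x) = cis (2 * pi * y) * cis (2 * pi * k)"
    by (simp add: cis_mult[symmetric] distrib_left)
  also have "cis (2 * pi * k) = 1" by (simp add: cis_multiple_2pi)
  finally show "cis (2 * pi * x) = cis (2 * pi * y)" by simp
qed

lemma circle_char_add: "circle_char (x + y) = circle_char x * circle_char y"
  by transfer (simp add: cis_mult distrib_left)

lemma norm_circle_char [simp]: "norm (circle_char x) = 1"
  by transfer simp

lemma inj_circle_char: "inj circle_char"
proof (rule injI, transfer)
  fix x y :: real assume "cis (2 * pi * x) = cis (2 * pi * y)"
  then have "sin (2 * pi * x) = sin (2 * pi * y) \<and> cos (2 * pi * x) = cos (2 * pi * y)"
    by (simp add: complex_eq_iff)
  then obtain n :: int where "2 * pi * x = 2 * pi * y + 2 * pi * n"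
    unfolding sin_cos_eq_iff by blast
  then have "2 * pi * x = 2 * pi * (y + n)" by (simp add: distrib_left)
  then have "x - y = of_int n" by simp
  then show "x - y \<in> \<int>" by simp
qed

lemma continuous_circle_char: "continuous_on UNIV circle_char"
proof (rule continuous_on_open_vimage[THEN iffD2, OF open_UNIV], intro allI impI)
  fix B :: "complex set" assume "open B"
  have "circle_of -` (circle_char -` B) = (\<lambda>x. cis (2 * pi * x)) -` B"
    by (auto simp: circle_char.abs_eq)
  moreover have "continuous_on UNIV (\<lambda>x. cis (2 * pi * x))"
    by (intro continuous_intros)
  ultimately show "open (circle_char -` B \<inter> UNIV)"
    using \<open>open B\<close> by (auto simp: open_circle_def continuous_on_open_vimage)
qed

instance circle :: t2_space
proof
  fix x y :: circle assume "x \<noteq> y"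
  then have "circle_char x \<noteq> circle_char y" using inj_circle_char by (auto dest: injD)
  then obtain U V where "open U" "open V" "circle_char x \<in> U" "circle_char y \<in> V" "U \<inter> V = {}"
    by (meson hausdorff)
  moreover from this have "open (circle_char -` U)" "open (circle_char -` V)"
    using continuous_circle_char by (auto simp: continuous_on_open_vimage)
  ultimately show "\<exists>U V. open U \<and> open V \<and> x \<in> U \<and> y \<in> V \<and> U \<inter> V = {}"
    by (intro exI[of _ "circle_char -` U"] exI[of _ "circle_char -` V"]) auto
qed

lemma compact_circle: "compact (UNIV :: circle set)"
proof -
  have "circle_of x \<in> circle_of ` {0..1}" for x
  proof -
    have "circle_of x = circle_of (frac x)"
      by (simp add: circle_of_eq_iff frac_def)
    then show ?thesis using frac_ge_0[of x] frac_lt_1[of x] by (intro image_eqI[of _ _ "frac x"]) auto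
  qed
  then have "circle_of ` {0..1} = UNIV"
    using surj_circle_of by (metis UNIV_eq_I rangeI surj_def)
  then show ?thesis
    by (metis compact_Icc compact_continuous_image continuous_circle_of continuous_on_subset subset_UNIV)
qed

text \<open>Finite powers of a topological group carry the product topology and inherit separation, countability
  and the continuity of the operations from their factor.\<close>

instance vec :: (t0_space, finite) t0_space
proof
  fix x y :: "'a ^ 'b" assume "x \<noteq> y"
  then obtain i where ne: "x $ i \<noteq> y $ i" by (auto simp: vec_eq_iff)
  then obtain U where "open U" "\<not> (x $ i \<in> U \<longleftrightarrow> y $ i \<in> U)"
    using Topological_Spaces.t0_space[OF ne] by blast
  then show "\<exists>U. open U \<and> \<not> (x \<in> U \<longleftrightarrow> y \<in> U)"
    by (intro exI[of _ "(\<lambda>z. z $ i) -` U"]) (auto intro: open_vimage_vec_nth)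
qed

instance vec :: (t1_space, finite) t1_space
proof
  fix x y :: "'a ^ 'b" assume "x \<noteq> y"
  then obtain i where ne: "x $ i \<noteq> y $ i" by (auto simp: vec_eq_iff)
  then obtain U where "open U" "x $ i \<in> U" "y $ i \<notin> U"
    using Topological_Spaces.t1_space[OF ne] by blast
  then show "\<exists>U. open U \<and> x \<in> U \<and> y \<notin> U"
    by (intro exI[of _ "(\<lambda>z. z $ i) -` U"]) (auto intro: open_vimage_vec_nth)
qed

instance vec :: (t2_space, finite) t2_space
proof
  fix x y :: "'a ^ 'b" assume "x \<noteq> y"
  then obtain i where ne: "x $ i \<noteq> y $ i" by (auto simp: vec_eq_iff)
  then obtain U V where "open U" "open V" "x $ i \<in> U" "y $ i \<in> V" "U \<inter> V = {}"
    using hausdorff[OF ne] by blast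
  then show "\<exists>U V. open U \<and> open V \<and> x \<in> U \<and> y \<in> V \<and> U \<inter> V = {}"
    by (intro exI[of _ "(\<lambda>z. z $ i) -` U"] exI[of _ "(\<lambda>z. z $ i) -` V"])
       (auto intro: open_vimage_vec_nth)
qed

instance vec :: (topological_monoid_add, finite) topological_monoid_add
proof
  fix a b :: "'a ^ 'b"
  have f: "((\<lambda>p. fst p $ i) \<longlongrightarrow> a $ i) (nhds a \<times>\<^sub>F nhds b)" for i
    by (intro tendsto_vec_nth filterlim_fst)
  have s: "((\<lambda>p. snd p $ i) \<longlongrightarrow> b $ i) (nhds a \<times>\<^sub>F nhds b)" for i
    by (intro tendsto_vec_nth filterlim_snd)
  show "LIM p (nhds a \<times>\<^sub>F nhds b). fst p + snd p :> nhds (a + b)"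
    using tendsto_add[OF f s] by (intro vec_tendstoI) simp
qed

instance vec :: (topological_comm_monoid_add, finite) topological_comm_monoid_add ..

instance vec :: (topological_group_add, finite) topological_group_add
proof
  fix a :: "'a ^ 'b"
  have "((\<lambda>x. x $ i) \<longlongrightarrow> a $ i) (nhds a)" for i
    by (intro tendsto_vec_nth filterlim_ident)
  from tendsto_minus[OF this] show "(uminus \<longlongrightarrow> - a) (nhds a)"
    by (intro vec_tendstoI) simp
qed

instance vec :: (topological_ab_group_add, finite) topological_ab_group_add ..

lemma continuous_on_vec_lambda_fun:
  "continuous_on UNIV (\<lambda>f :: 'b::finite \<Rightarrow> 'a::topological_space. vec_lambda f)"
  unfolding continuous_on_def
  by (intro ballI vec_tendstoI) (simp, metis UNIV_I continuous_on_def continuous_on_product_coordinates)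

lemma compact_Pi_UNIV:
  fixes K :: "'i \<Rightarrow> 'a::topological_space set"
  assumes "\<And>i. compact (K i)"
  shows "compact (Pi UNIV K)"
proof -
  have "compactin (product_topology (\<lambda>i. euclidean) UNIV) (PiE UNIV K)"
    using assms by (simp add: compactin_PiE)
  then have "compactin euclidean (PiE UNIV K)"
    by (metis euclidean_product_topology)
  then show ?thesis by (simp add: PiE_UNIV_domain)
qed

lemma compact_vec_UNIV:
  assumes "compact (UNIV :: 'a::topological_space set)"
  shows "compact (UNIV :: ('a ^ 'b::finite) set)"
proof -
  have "compact (UNIV :: ('b \<Rightarrow> 'a) set)"
    using compact_Pi_UNIV[of "\<lambda>_ :: 'b. UNIV :: 'a set"] assms by simp
  then have "compact (range (vec_lambda :: ('b \<Rightarrow> 'a) \<Rightarrow> 'a ^ 'b))"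
    by (intro compact_continuous_image continuous_on_vec_lambda_fun)
  moreover have "range (vec_lambda :: ('b \<Rightarrow> 'a) \<Rightarrow> 'a ^ 'b) = UNIV"
    by (metis surjI vec_nth_inverse)
  ultimately show ?thesis by simp
qed

lemma open_vimage_nth_fun:
  "open U \<Longrightarrow> open ((\<lambda>v :: 'a::topological_space ^ 'b::finite. ($) v) -` U)"
proof -
  assume "open U"
  have "continuous_on UNIV (\<lambda>v :: 'a ^ 'b. ($) v)"
    by (rule continuous_on_coordinatewise_then_product) (auto intro: continuous_intros)
  with \<open>open U\<close> show ?thesis
    by (simp add: continuous_on_open_vimage)
qed

instance vec :: (first_countable_topology, finite) first_countable_topology
proof
  fix x :: "'a ^ 'b"
  obtain A :: "nat \<Rightarrow> ('b \<Rightarrow> 'a) set" where A: "\<And>i. ($) x \<in> A i" "\<And>i. open (A i)"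
      "\<And>S. open S \<Longrightarrow> ($) x \<in> S \<Longrightarrow> \<exists>i. A i \<subseteq> S"
    using first_countable_topology_class.first_countable_basis[of "($) x"] by auto
  have "\<exists>i. (\<lambda>v. ($) v) -` A i \<subseteq> S" if S: "open S" "x \<in> S" for S :: "('a ^ 'b) set"
  proof -
    have "open (vec_lambda -` S)"
      using S continuous_on_vec_lambda_fun by (auto simp: continuous_on_open_vimage)
    then obtain i where "A i \<subseteq> vec_lambda -` S" using A(3)[of "vec_lambda -` S"] S(2) by auto
    then show ?thesis by (intro exI[of _ i]) force
  qed
  then show "\<exists>A::nat \<Rightarrow> ('a ^ 'b) set. (\<forall>i. x \<in> A i \<and> open (A i)) \<and> (\<forall>S. open S \<and> x \<in> S \<longrightarrow> (\<exists>i. A i \<subseteq> S))"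
    using A(1,2) by (intro exI[of _ "\<lambda>i. (\<lambda>v. ($) v) -` A i"]) (auto intro!: open_vimage_nth_fun)
qed

instance vec :: (second_countable_topology, finite) second_countable_topology
proof
  obtain B :: "('b \<Rightarrow> 'a) set set" where B: "countable B" "topological_basis B"
    using ex_countable_basis by blast
  have "topological_basis ((\<lambda>U. (\<lambda>v :: 'a ^ 'b. ($) v) -` U) ` B)"
  proof (rule topological_basisI)
    fix U :: "('a ^ 'b) set" and a assume U: "open U" "a \<in> U"
    have "open (vec_lambda -` U)" "($) a \<in> vec_lambda -` U"
      using U continuous_on_vec_lambda_fun by (auto simp: continuous_on_open_vimage)
    then obtain V where "V \<in> B" "($) a \<in> V" "V \<subseteq> vec_lambda -` U"
      using topological_basisE[OF B(2)] by metis
    then show "\<exists>W\<in>(\<lambda>U. (\<lambda>v :: 'a ^ 'b. ($) v) -` U) ` B. a \<in> W \<and> W \<subseteq> U"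
      by (intro bexI[of _ "(\<lambda>v :: 'a ^ 'b. ($) v) -` V"]) auto
  qed (auto intro!: open_vimage_nth_fun topological_basis_open[OF B(2)])
  then show "\<exists>B::('a ^ 'b) set set. countable B \<and> open = generate_topology B"
    using B(1) by (metis countable_image topological_basis_imp_subbasis)
qed

section \<open>Wasserstein convergence tests continuous functions\<close>

text \<open>Expressing ``for all admissible measures at small distance from \<open>\<nu>\<^sub>0\<close>'' as a filter makes the
  calculus of limits available for integrals that vary with the measure.\<close>

definition W1_nhds :: "'a::metric_space measure \<Rightarrow> 'a measure filter"
  where "W1_nhds \<nu>\<^sub>0 = (INF \<delta>\<in>{0<..}. principal {\<nu> \<in> Prob_c. W1 \<nu> \<nu>\<^sub>0 < \<delta>})"

lemma eventually_W1_nhds: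
  "eventually P (W1_nhds \<nu>\<^sub>0) \<longleftrightarrow> (\<exists>\<delta>>0. \<forall>\<nu>\<in>Prob_c. W1 \<nu> \<nu>\<^sub>0 < \<delta> \<longrightarrow> P \<nu>)"
proof -
  have "\<exists>x\<in>{0<..}. principal {\<nu> \<in> Prob_c. W1 \<nu> \<nu>\<^sub>0 < x}
      \<le> inf (principal {\<nu> \<in> Prob_c. W1 \<nu> \<nu>\<^sub>0 < a}) (principal {\<nu> \<in> Prob_c. W1 \<nu> \<nu>\<^sub>0 < b})"
    if "a \<in> {0<..}" "b \<in> {0<..}" for a b :: real
    using that by (intro bexI[of _ "min a b"]) auto
  then show ?thesis
    unfolding W1_nhds_def by (subst eventually_INF_base) (auto simp: eventually_principal)
qed

lemma Prob_cD:
  assumes "\<nu> \<in> Prob_c"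
  shows "prob_space \<nu>" "sets \<nu> = sets borel" "space \<nu> = UNIV" "compact (measure_support \<nu>)"
  using assms sets_eq_imp_space_eq[of \<nu> borel] by (auto simp: Prob_c_def)

text \<open>The complement of the support is covered by the basic open sets of measure zero, and a countable
  base has only countably many of them.\<close>

lemma AE_measure_support:
  fixes \<nu> :: "'a::second_countable_topology measure"
  assumes sets: "sets \<nu> = sets borel"
  shows "AE x in \<nu>. x \<in> measure_support \<nu>"
proof -
  obtain B :: "'a set set" where B: "countable B" "topological_basis B"
    using ex_countable_basis by blast
  define N where "N = \<Union>{U \<in> B. emeasure \<nu> U = 0}"
  have "U \<in> sets \<nu>" if "U \<in> B" for U
    using topological_basis_open[OF B(2) that] sets by auto
  then have "N \<in> null_sets \<nu>"
    unfolding N_def using B(1) by (intro null_sets_UN'[of _ "\<lambda>U. U", simplified]) (auto simp: null_sets_def)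
  moreover have "{x \<in> space \<nu>. x \<notin> measure_support \<nu>} \<subseteq> N"
  proof
    fix x assume "x \<in> {x \<in> space \<nu>. x \<notin> measure_support \<nu>}"
    then obtain U where U: "open U" "x \<in> U" "emeasure \<nu> U = 0"
      by (auto simp: measure_support_def)
    obtain V where V: "V \<in> B" "x \<in> V" "V \<subseteq> U"
      using topological_basisE[OF B(2) U(1,2)] .
    have "emeasure \<nu> V \<le> emeasure \<nu> U"
      using V U(1) sets by (intro emeasure_mono) auto
    then show "x \<in> N" using V U(3) by (auto simp: N_def)
  qed
  ultimately show ?thesis by (rule AE_I')
qed

lemma measure_support_nonempty:
  fixes \<nu> :: "'a::second_countable_topology measure"
  assumes "\<nu> \<in> Prob_c" shows "measure_support \<nu> \<noteq> {}"
proof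
  assume "measure_support \<nu> = {}"
  then have "AE x in \<nu>. False" using AE_measure_support[OF Prob_cD(2)[OF assms]] by simp
  then show False using Prob_cD(1)[OF assms] by (simp add: prob_space.AE_False)
qed

lemma integrable_lipschitz_Prob_c:
  fixes g :: "'a::{metric_space, second_countable_topology} \<Rightarrow> real"
  assumes \<nu>: "\<nu> \<in> Prob_c" and g: "C-lipschitz_on UNIV g"
  shows "integrable \<nu> g"
proof -
  interpret prob_space \<nu> using Prob_cD(1)[OF \<nu>] .
  have cont: "continuous_on UNIV g" by (rule lipschitz_on_continuous_on[OF g])
  then have "bounded (g ` measure_support \<nu>)"
    by (meson Prob_cD(4)[OF \<nu>] compact_continuous_image compact_imp_bounded continuous_on_subset subset_UNIV)
  then obtain B where "\<And>x. x \<in> measure_support \<nu> \<Longrightarrow> norm (g x) \<le> B"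
    by (auto simp: bounded_iff)
  then have "AE x in \<nu>. norm (g x) \<le> B"
    using AE_measure_support[OF Prob_cD(2)[OF \<nu>]] by (auto elim: eventually_mono)
  moreover have "g \<in> borel_measurable \<nu>"
    using borel_measurable_continuous_onI[OF cont] Prob_cD(2)[OF \<nu>] by (simp cong: measurable_cong_sets)
  ultimately show ?thesis by (intro integrable_const_bound)
qed

text \<open>The supremum of reals that defines the distance is only meaningful on a bounded set. It is
  bounded because a 1-Lipschitz function differs from its value at \<open>z\<close> by at most the distance to \<open>z\<close>,
  whose integral is finite for compactly supported measures.\<close>

lemma integral_diff_le_W1:
  fixes \<nu> \<nu>\<^sub>0 :: "'a::{metric_space, second_countable_topology} measure"
  assumes \<nu>: "\<nu> \<in> Prob_c" and \<nu>\<^sub>0: "\<nu>\<^sub>0 \<in> Prob_c" and g: "1-lipschitz_on UNIV g"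
  shows "(\<integral>x. g x \<partial>\<nu>) - (\<integral>x. g x \<partial>\<nu>\<^sub>0) \<le> W1 \<nu> \<nu>\<^sub>0"
proof -
  fix z :: 'a
  have lip: "1-lipschitz_on UNIV (\<lambda>x. dist x z)"
  proof (rule lipschitz_onI)
    show "dist (dist x z) (dist y z) \<le> 1 * dist x y" for x y :: 'a
      using abs_dist_diff_le[of x z y] by (simp add: dist_real_def dist_commute)
  qed simp
  have "(\<integral>x. h x \<partial>\<nu>) - (\<integral>x. h x \<partial>\<nu>\<^sub>0) \<le> (\<integral>x. dist x z \<partial>\<nu>) + (\<integral>x. dist x z \<partial>\<nu>\<^sub>0)"
    if h: "1-lipschitz_on UNIV h" for h :: "'a \<Rightarrow> real"
  proof -
    interpret n: prob_space \<nu> using Prob_cD(1)[OF \<nu>] .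
    interpret n0: prob_space \<nu>\<^sub>0 using Prob_cD(1)[OF \<nu>\<^sub>0] .
    have b: "\<bar>h x - h z\<bar> \<le> dist x z" for x
      using lipschitz_onD[OF h, of x z] by (simp add: dist_real_def)
    have "(\<integral>x. h x \<partial>\<nu>) \<le> (\<integral>x. h z + dist x z \<partial>\<nu>)"
      using b by (intro integral_mono integrable_lipschitz_Prob_c[OF \<nu> h] Bochner_Integration.integrable_add
          n.integrable_const integrable_lipschitz_Prob_c[OF \<nu> lip]) (auto simp: abs_le_iff algebra_simps)
    moreover have "(\<integral>x. h z - dist x z \<partial>\<nu>\<^sub>0) \<le> (\<integral>x. h x \<partial>\<nu>\<^sub>0)"
      using b by (intro integral_mono integrable_lipschitz_Prob_c[OF \<nu>\<^sub>0 h] Bochner_Integration.integrable_diff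
          n0.integrable_const integrable_lipschitz_Prob_c[OF \<nu>\<^sub>0 lip]) (auto simp: abs_le_iff algebra_simps)
    ultimately show ?thesis
      using integrable_lipschitz_Prob_c[OF \<nu> lip] integrable_lipschitz_Prob_c[OF \<nu>\<^sub>0 lip]
      by (simp add: n.prob_space n0.prob_space)
  qed
  then show ?thesis
    unfolding W1_def using g by (intro cSUP_upper bdd_aboveI2) auto
qed

lemma eventually_Prob_c: "eventually (\<lambda>\<nu>. \<nu> \<in> Prob_c) (W1_nhds \<nu>\<^sub>0)"
  unfolding eventually_W1_nhds by (intro exI[of _ 1]) auto

lemma W1_self:
  fixes \<nu> :: "'a::{metric_space, second_countable_topology} measure"
  shows "W1 \<nu> \<nu> = 0"
proof -
  have "{g :: 'a \<Rightarrow> real. 1-lipschitz_on UNIV g} \<noteq> {}"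
    by (auto intro!: exI[of _ "\<lambda>_. 0"] lipschitz_intros lipschitz_on_le[OF lipschitz_on_constant])
  then show ?thesis by (simp add: W1_def)
qed

lemma eventually_W1_nhds_self:
  fixes \<nu>\<^sub>0 :: "'a::{metric_space, second_countable_topology} measure"
  assumes "eventually P (W1_nhds \<nu>\<^sub>0)" "\<nu>\<^sub>0 \<in> Prob_c" shows "P \<nu>\<^sub>0"
  using assms by (auto simp: eventually_W1_nhds W1_self)

text \<open>The infimal convolution of \<open>g\<close> with \<open>n\<close> times the distance, which for bounded \<open>g\<close> is the
  largest \<open>n\<close>-Lipschitz function below \<open>g\<close>.\<close>

definition lipschitz_minorant :: "('a::metric_space \<Rightarrow> real) \<Rightarrow> nat \<Rightarrow> 'a \<Rightarrow> real"
  where "lipschitz_minorant g n x = (INF y. g y + real n * dist x y)"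

lemma lipschitz_minorant:
  fixes g :: "'a::metric_space \<Rightarrow> real"
  assumes "continuous_on UNIV g" "bounded (range g)"
  shows "(real n)-lipschitz_on UNIV (lipschitz_minorant g n)"
    and "lipschitz_minorant g n x \<le> g x"
    and "(\<lambda>n. lipschitz_minorant g n x) \<longlonglongrightarrow> g x"
    and "(\<And>y. c \<le> g y) \<Longrightarrow> c \<le> lipschitz_minorant g n x"
proof -
  obtain K where K: "\<And>x. \<bar>g x\<bar> \<le> K" using assms(2) by (auto simp: bounded_iff)
  have lower: "bdd_below (range (\<lambda>y. g y + real n * dist x y))" for n x
  proof (rule bdd_belowI2)
    fix y show "- K \<le> g y + real n * dist x y"
    proof -
      have "0 \<le> real n * dist x y" by simp
      then show ?thesis using K[of y] by linarith
    qed
  qed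
  show le: "lipschitz_minorant g n x \<le> g x" for n x
    unfolding lipschitz_minorant_def using cINF_lower[OF lower, of x n x] by simp
  show ge: "c \<le> lipschitz_minorant g n x" if "\<And>y. c \<le> g y" for c n x
    unfolding lipschitz_minorant_def using that by (intro cINF_greatest) (auto intro: add_increasing2)
  have one: "lipschitz_minorant g n x \<le> lipschitz_minorant g n x' + real n * dist x x'" for n x x'
  proof -
    have "lipschitz_minorant g n x - real n * dist x x' \<le> lipschitz_minorant g n x'"
      unfolding lipschitz_minorant_def
    proof (rule cINF_greatest)
      fix y
      have "(INF y. g y + real n * dist x y) \<le> g y + real n * dist x y"
        by (rule cINF_lower[OF lower]) simp
      also have "real n * dist x y \<le> real n * (dist x x' + dist x' y)"
        by (intro mult_left_mono dist_triangle) simp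
      finally show "(INF y. g y + real n * dist x y) - real n * dist x x' \<le> g y + real n * dist x' y"
        by (simp add: algebra_simps)
    qed simp
    then show ?thesis by simp
  qed
  show "(real n)-lipschitz_on UNIV (lipschitz_minorant g n)" for n
  proof (rule lipschitz_onI)
    fix x y show "dist (lipschitz_minorant g n x) (lipschitz_minorant g n y) \<le> real n * dist x y"
      using one[of n x y] one[of n y x] by (simp add: dist_real_def abs_le_iff dist_commute)
  qed simp
  show "(\<lambda>n. lipschitz_minorant g n x) \<longlonglongrightarrow> g x"
  proof (rule LIMSEQ_I)
    fix r :: real assume "r > 0"
    obtain s where s: "s > 0" "\<And>y. dist y x < s \<Longrightarrow> dist (g y) (g x) < r / 2"
      using assms(1) \<open>r > 0\<close> unfolding continuous_on_iff by (metis UNIV_I half_gt_zero)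
    obtain n0 :: nat where n0: "2 * K / s \<le> n0" using real_arch_simple by blast
    have "norm (lipschitz_minorant g n x - g x) < r" if "n \<ge> n0" for n
    proof -
      have "g x - r / 2 \<le> lipschitz_minorant g n x"
        unfolding lipschitz_minorant_def
      proof (rule cINF_greatest)
        fix y
        show "g x - r / 2 \<le> g y + real n * dist x y"
        proof (cases "dist y x < s")
          case True
          then have "g x - r / 2 \<le> g y" using s(2)[OF True] unfolding dist_real_def by linarith
          then show ?thesis by (simp add: add_increasing2)
        next
          case False
          have "2 * K \<le> real n0 * s" using n0 s(1) by (simp add: field_simps)
          also have "\<dots> \<le> real n * dist x y"
            using False that s(1) by (intro mult_mono) (auto simp: dist_commute)
          finally show ?thesis using K[of x] K[of y] \<open>r > 0\<close> by (simp add: abs_le_iff)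
        qed
      qed simp
      then show ?thesis using le[of n x] \<open>r > 0\<close> by simp
    qed
    then show "\<exists>no. \<forall>n\<ge>no. norm (lipschitz_minorant g n x - g x) < r" by blast
  qed
qed

text \<open>Lower semicontinuity of the integral: some Lipschitz minorant has almost the same integral with
  respect to \<open>\<nu>\<^sub>0\<close> by dominated convergence, its integral is Lipschitz in the measure, and it lies
  below \<open>g\<close>. Applied to \<open>g\<close> and to \<open>- g\<close>, this gives weak convergence.\<close>

lemma eventually_integral_gt:
  fixes g :: "'a::{metric_space, second_countable_topology} \<Rightarrow> real"
  assumes \<nu>\<^sub>0: "\<nu>\<^sub>0 \<in> Prob_c" and g: "continuous_on UNIV g" "bounded (range g)" and "e > 0"
  shows "\<forall>\<^sub>F \<nu> in W1_nhds \<nu>\<^sub>0. (\<integral>x. g x \<partial>\<nu>\<^sub>0) - e < (\<integral>x. g x \<partial>\<nu>)"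
proof -
  define f where "f = lipschitz_minorant g"
  note f = lipschitz_minorant[OF g, folded f_def]
  obtain K where K: "\<And>x. \<bar>g x\<bar> \<le> K" using g(2) by (auto simp: bounded_iff)
  have fK: "\<bar>f n x\<bar> \<le> K" for n x
  proof -
    have "- K \<le> f n x" using K by (intro f(4)) (metis abs_le_D2 minus_le_iff)
    moreover have "f n x \<le> K" using f(2)[of n x] K[of x] by linarith
    ultimately show ?thesis by linarith
  qed
  interpret n0: prob_space \<nu>\<^sub>0 using Prob_cD(1)[OF \<nu>\<^sub>0] .
  have meas: "h \<in> borel_measurable \<nu>" if "\<nu> \<in> Prob_c" "continuous_on UNIV h" for \<nu> and h :: "'a \<Rightarrow> real"
    using borel_measurable_continuous_onI[OF that(2)] Prob_cD(2)[OF that(1)] by (simp cong: measurable_cong_sets)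
  have "(\<lambda>n. \<integral>x. f n x \<partial>\<nu>\<^sub>0) \<longlonglongrightarrow> (\<integral>x. g x \<partial>\<nu>\<^sub>0)"
    by (rule integral_dominated_convergence[where w="\<lambda>_. K"])
       (auto intro!: meas[OF \<nu>\<^sub>0] g lipschitz_on_continuous_on[OF f(1)] f(3) fK)
  then have "\<forall>\<^sub>F n in sequentially. (\<integral>x. g x \<partial>\<nu>\<^sub>0) - e / 2 < (\<integral>x. f n x \<partial>\<nu>\<^sub>0)"
    using \<open>e > 0\<close> by (intro order_tendstoD) auto
  then have "\<forall>\<^sub>F n in sequentially. (\<integral>x. g x \<partial>\<nu>\<^sub>0) - e / 2 < (\<integral>x. f n x \<partial>\<nu>\<^sub>0) \<and> n > 0"
    by (intro eventually_conj eventually_gt_at_top)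
  then obtain n where n: "(\<integral>x. g x \<partial>\<nu>\<^sub>0) - e / 2 < (\<integral>x. f n x \<partial>\<nu>\<^sub>0)" "n > 0"
    using eventually_happens by fastforce
  have "(\<integral>x. g x \<partial>\<nu>\<^sub>0) - e < (\<integral>x. g x \<partial>\<nu>)"
    if \<nu>: "\<nu> \<in> Prob_c" and W: "W1 \<nu> \<nu>\<^sub>0 < e / (2 * n)" for \<nu>
  proof -
    interpret n: prob_space \<nu> using Prob_cD(1)[OF \<nu>] .
    have "1-lipschitz_on UNIV (\<lambda>x. - (f n x / n))"
      using lipschitz_onD[OF f(1)[of n]] \<open>n > 0\<close>
      by (intro lipschitz_onI) (auto simp: dist_real_def field_simps abs_minus_commute simp flip: diff_divide_distrib)
    from integral_diff_le_W1[OF \<nu> \<nu>\<^sub>0 this]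
    have "((\<integral>x. f n x \<partial>\<nu>\<^sub>0) - (\<integral>x. f n x \<partial>\<nu>)) / n \<le> W1 \<nu> \<nu>\<^sub>0"
      by (simp add: diff_divide_distrib)
    also note W
    finally have "((\<integral>x. f n x \<partial>\<nu>\<^sub>0) - (\<integral>x. f n x \<partial>\<nu>)) / n * n < e / (2 * n) * n"
      using n(2) by (intro mult_strict_right_mono) auto
    then have "(\<integral>x. f n x \<partial>\<nu>\<^sub>0) - (\<integral>x. f n x \<partial>\<nu>) < e / 2"
      using n(2) by simp
    moreover have "(\<integral>x. f n x \<partial>\<nu>) \<le> (\<integral>x. g x \<partial>\<nu>)"
      using K by (intro integral_mono integrable_lipschitz_Prob_c[OF \<nu> f(1)] f(2) n.integrable_const_bound[where B=K] meas \<nu> g) auto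
    ultimately show ?thesis using n(1) by simp
  qed
  then show ?thesis
    unfolding eventually_W1_nhds using \<open>e > 0\<close> n(2) by (intro exI[of _ "e / (2 * n)"]) auto
qed

lemma tendsto_integral_W1_nhds_real:
  fixes g :: "'a::{metric_space, second_countable_topology} \<Rightarrow> real"
  assumes \<nu>\<^sub>0: "\<nu>\<^sub>0 \<in> Prob_c" and g: "continuous_on UNIV g" "bounded (range g)"
  shows "((\<lambda>\<nu>. \<integral>x. g x \<partial>\<nu>) \<longlongrightarrow> (\<integral>x. g x \<partial>\<nu>\<^sub>0)) (W1_nhds \<nu>\<^sub>0)"
proof (rule tendstoI)
  fix e :: real assume "e > 0"
  have "continuous_on UNIV (\<lambda>x. - g x)" "bounded (range (\<lambda>x. - g x))"
    using g by (auto intro!: continuous_intros simp: bounded_iff)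
  from eventually_integral_gt[OF \<nu>\<^sub>0 g \<open>e > 0\<close>] eventually_integral_gt[OF \<nu>\<^sub>0 this \<open>e > 0\<close>]
  show "\<forall>\<^sub>F \<nu> in W1_nhds \<nu>\<^sub>0. dist (\<integral>x. g x \<partial>\<nu>) (\<integral>x. g x \<partial>\<nu>\<^sub>0) < e"
    by eventually_elim (auto simp: dist_real_def)
qed

lemma continuous_bounded_integrable:
  fixes g :: "'a::topological_space \<Rightarrow> 'b::{banach, second_countable_topology}"
  assumes "prob_space \<nu>" "sets \<nu> = sets borel" "continuous_on UNIV g" "bounded (range g)"
  shows "integrable \<nu> g"
proof -
  interpret prob_space \<nu> by fact
  obtain B where "\<And>x. norm (g x) \<le> B" using assms(4) by (auto simp: bounded_iff)
  then show ?thesis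
    using borel_measurable_continuous_onI[OF assms(3)] assms(2)
    by (intro integrable_const_bound[where B=B]) (auto cong: measurable_cong_sets)
qed

lemma tendsto_integral_W1_nhds:
  fixes g :: "'a::{metric_space, second_countable_topology} \<Rightarrow> complex"
  assumes \<nu>\<^sub>0: "\<nu>\<^sub>0 \<in> Prob_c" and g: "continuous_on UNIV g" "bounded (range g)"
  shows "((\<lambda>\<nu>. \<integral>x. g x \<partial>\<nu>) \<longlongrightarrow> (\<integral>x. g x \<partial>\<nu>\<^sub>0)) (W1_nhds \<nu>\<^sub>0)"
proof -
  have int: "integrable \<nu> g" if "\<nu> \<in> Prob_c" for \<nu>
    using Prob_cD(1,2)[OF that] g by (rule continuous_bounded_integrable)
  have eq: "(\<integral>x. g x \<partial>\<nu>) = Complex (\<integral>x. Re (g x) \<partial>\<nu>) (\<integral>x. Im (g x) \<partial>\<nu>)" if "\<nu> \<in> Prob_c" for \<nu>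
    using int[OF that] by (simp add: complex_eq_iff)
  have "bounded (range (\<lambda>x. Re (g x)))" "bounded (range (\<lambda>x. Im (g x)))"
    using g(2) by (auto simp: bounded_iff intro: order_trans[OF abs_Re_le_cmod] order_trans[OF abs_Im_le_cmod])
  then have "((\<lambda>\<nu>. Complex (\<integral>x. Re (g x) \<partial>\<nu>) (\<integral>x. Im (g x) \<partial>\<nu>)) \<longlongrightarrow> (\<integral>x. g x \<partial>\<nu>\<^sub>0)) (W1_nhds \<nu>\<^sub>0)"
    unfolding eq[OF \<nu>\<^sub>0]
    by (intro tendsto_Complex tendsto_integral_W1_nhds_real \<nu>\<^sub>0 continuous_intros g)
  then show ?thesis
    by (rule Lim_transform_eventually) (use eventually_Prob_c in eventually_elim, simp add: eq)
qed

section \<open>A Chernoff bound for one-sided skew products\<close>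

text \<open>The \<open>j\<close>-th iterate of the skew product over the one-sided shift.\<close>

definition orbit :: "('a \<Rightarrow> 't::ab_group_add) \<Rightarrow> nat \<Rightarrow> (nat \<Rightarrow> 'a) \<times> 't \<Rightarrow> (nat \<Rightarrow> 'a) \<times> 't"
  where "orbit a j = (\<lambda>(x, \<theta>). (\<lambda>n. x (n + j), \<theta> + (\<Sum>i<j. a (x i))))"

definition depends_below :: "nat \<Rightarrow> ((nat \<Rightarrow> 'a) \<times> 't \<Rightarrow> 'b) \<Rightarrow> bool"
  where "depends_below p \<psi> \<longleftrightarrow> (\<forall>x y \<theta>. (\<forall>i<p. x i = y i) \<longrightarrow> \<psi> (x, \<theta>) = \<psi> (y, \<theta>))"

definition iid :: "'a measure \<Rightarrow> (nat \<Rightarrow> 'a) measure"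
  where "iid \<nu> = Pi\<^sub>M UNIV (\<lambda>_. \<nu>)"

lemma sum_lessThan_add:
  fixes f :: "nat \<Rightarrow> 'a::comm_monoid_add"
  shows "(\<Sum>j<m + k. f j) = (\<Sum>j<m. f j) + (\<Sum>j<k. f (m + j))"
  by (induction k) (auto simp: add.assoc)

lemma orbit_0 [simp]: "orbit a 0 z = z"
  by (cases z) (simp add: orbit_def)

lemma orbit_add: "orbit a (i + j) z = orbit a j (orbit a i z)"
  by (cases z) (simp add: orbit_def sum_lessThan_add add.assoc add.left_commute add.commute)

lemma continuous_on_fst_component:
  "continuous_on UNIV (\<lambda>z :: ('i \<Rightarrow> 'a::topological_space) \<times> 't::topological_space. fst z i)"
proof -
  have "continuous_on UNIV (\<lambda>x :: 'i \<Rightarrow> 'a. x i)"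
    by (rule continuous_on_product_coordinates)
  from continuous_on_compose2[OF this continuous_on_fst[OF continuous_on_id], of UNIV] show ?thesis
    by simp
qed

lemma continuous_on_orbit:
  fixes a :: "'a::topological_space \<Rightarrow> 't::topological_ab_group_add"
  assumes "continuous_on UNIV a"
  shows "continuous_on UNIV (orbit a j)"
proof -
  have "continuous_on UNIV (\<lambda>z :: (nat \<Rightarrow> 'a) \<times> 't. (\<lambda>n. fst z (n + j)))"
    by (rule continuous_on_coordinatewise_then_product) (rule continuous_on_fst_component)
  moreover have "continuous_on UNIV (\<lambda>z :: (nat \<Rightarrow> 'a) \<times> 't. snd z + (\<Sum>i<j. a (fst z i)))"
    by (intro continuous_on_add continuous_on_sum continuous_on_snd continuous_on_id
        continuous_on_compose2[OF assms continuous_on_fst_component]) auto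
  ultimately show ?thesis
    unfolding orbit_def split_def by (rule continuous_on_Pair)
qed

lemma depends_below_orbit:
  assumes "depends_below p \<psi>" "j + p \<le> q"
  shows "depends_below q (\<lambda>z. \<psi> (orbit a j z))"
  unfolding depends_below_def
proof (intro allI impI)
  fix x y :: "nat \<Rightarrow> 'a" and \<theta> assume eq: "\<forall>i<q. x i = y i"
  then have "(\<Sum>i<j. a (x i)) = (\<Sum>i<j. a (y i))"
    using assms(2) by (intro sum.cong) auto
  moreover have "\<forall>i<p. x (i + j) = y (i + j)" using eq assms(2) by auto
  ultimately show "\<psi> (orbit a j (x, \<theta>)) = \<psi> (orbit a j (y, \<theta>))"
    using assms(1) by (simp add: orbit_def depends_below_def)
qed

lemma space_iid: "sets \<nu> = sets borel \<Longrightarrow> space (iid \<nu>) = UNIV"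
  using sets_eq_imp_space_eq[of \<nu> borel] by (simp add: iid_def space_PiM)

lemma sets_iid:
  fixes \<nu> :: "'a::second_countable_topology measure"
  assumes "sets \<nu> = sets borel" shows "sets (iid \<nu>) = sets borel"
proof -
  have "sets (iid \<nu>) = sets (Pi\<^sub>M UNIV (\<lambda>_ :: nat. borel :: 'a measure))"
    unfolding iid_def by (rule sets_PiM_cong) (use assms in auto)
  then show ?thesis by (simp add: sets_PiM_equal_borel)
qed

lemma prob_space_iid: "prob_space \<nu> \<Longrightarrow> prob_space (iid \<nu>)"
  unfolding iid_def by (rule prob_space_PiM)

lemma measurable_iid_section:
  fixes \<psi> :: "(nat \<Rightarrow> 'a::second_countable_topology) \<times> 't::topological_space \<Rightarrow> 'b::topological_space"
  assumes "sets \<nu> = sets borel" "continuous_on UNIV \<psi>"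
  shows "(\<lambda>x. \<psi> (x, \<theta>)) \<in> borel_measurable (iid \<nu>)"
proof -
  have "continuous_on UNIV (\<lambda>x. \<psi> (x, \<theta>))"
    by (intro continuous_on_compose2[OF assms(2)] continuous_intros) auto
  then show ?thesis
    using borel_measurable_continuous_onI sets_iid[OF assms(1)] by (simp cong: measurable_cong_sets)
qed

lemma integrable_iid_section:
  fixes \<psi> :: "(nat \<Rightarrow> 'a::second_countable_topology) \<times> 't::topological_space \<Rightarrow> 'b::{banach, second_countable_topology}"
  assumes "prob_space \<nu>" "sets \<nu> = sets borel" "continuous_on UNIV \<psi>" "\<And>z. norm (\<psi> z) \<le> K"
  shows "integrable (iid \<nu>) (\<lambda>x. \<psi> (x, \<theta>))"
proof -
  interpret prob_space "iid \<nu>" using prob_space_iid[OF assms(1)] .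
  show ?thesis
    using assms by (intro integrable_const_bound[where B=K] measurable_iid_section) auto
qed

lemma integral_iid_prod:
  fixes h :: "nat \<Rightarrow> 'a \<Rightarrow> complex"
  assumes "prob_space \<nu>" "\<And>i. i < M \<Longrightarrow> integrable \<nu> (h i)"
  shows "(\<integral>x. (\<Prod>i<M. h i (x i)) \<partial>iid \<nu>) = (\<Prod>i<M. \<integral>x. h i x \<partial>\<nu>)"
proof -
  interpret product_prob_space "\<lambda>_ :: nat. \<nu>" UNIV
    using assms(1) by (intro product_prob_spaceI)
  have "(\<Prod>i<M. \<integral>x. h i x \<partial>\<nu>) = (\<integral>x. (\<Prod>i<M. h i (x i)) \<partial>Pi\<^sub>M {..<M} (\<lambda>_. \<nu>))"
    using assms(2) by (subst product_integral_prod) auto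
  also have "Pi\<^sub>M {..<M} (\<lambda>_. \<nu>) = distr (iid \<nu>) (Pi\<^sub>M {..<M} (\<lambda>_. \<nu>)) (\<lambda>x. restrict x {..<M})"
    unfolding iid_def by (rule distr_PiM_restrict_finite[symmetric]) auto
  also have "(\<integral>x. (\<Prod>i<M. h i (x i)) \<partial>\<dots>) = (\<integral>x. (\<Prod>i<M. h i (restrict x {..<M} i)) \<partial>iid \<nu>)"
  proof (rule integral_distr)
    show "(\<lambda>x. restrict x {..<M}) \<in> measurable (iid \<nu>) (Pi\<^sub>M {..<M} (\<lambda>_. \<nu>))"
      unfolding iid_def by (rule measurable_restrict_subset) simp
    show "(\<lambda>x. \<Prod>i<M. h i (x i)) \<in> borel_measurable (Pi\<^sub>M {..<M} (\<lambda>_. \<nu>))"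
      using assms(2) by (intro borel_measurable_prod measurable_compose[OF measurable_component_singleton]) auto
  qed
  finally show ?thesis by simp
qed

lemma integral_iid_component:
  fixes h :: "'a::second_countable_topology \<Rightarrow> real"
  assumes "prob_space \<nu>" "h \<in> borel_measurable \<nu>"
  shows "(\<integral>x. h (x i) \<partial>iid \<nu>) = (\<integral>x. h x \<partial>\<nu>)"
proof -
  have "\<nu> = distr (iid \<nu>) \<nu> (\<lambda>x. x i)"
    unfolding iid_def by (rule distr_PiM_component[symmetric]) (use assms in auto)
  then have "(\<integral>x. h x \<partial>\<nu>) = (\<integral>x. h x \<partial>distr (iid \<nu>) \<nu> (\<lambda>x. x i))" by simp
  also have "\<dots> = (\<integral>x. h (x i) \<partial>iid \<nu>)"
    using assms by (intro integral_distr) (auto simp: iid_def)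
  finally show ?thesis by simp
qed

text \<open>The coordinates from \<open>L\<close> on are again an independent sequence, independent of those below \<open>L\<close>. Since
  the first block depends only on the latter, its factor can be pulled out of the inner integral over
  the future; there the induction hypothesis applies with whatever angle the first block has led
  to, which is why the bound \<open>C\<close> is required for all angles.\<close>

lemma exp_moment_blocks:
  fixes a :: "'a::second_countable_topology \<Rightarrow> 't::topological_ab_group_add"
    and B :: "(nat \<Rightarrow> 'a) \<times> 't \<Rightarrow> real"
  assumes \<nu>: "prob_space \<nu>" "sets \<nu> = sets borel" and a: "continuous_on UNIV a"
    and B: "continuous_on UNIV B" "depends_below L B"
    and C: "\<And>\<theta>. (\<integral>\<^sup>+x. ennreal (exp (B (x, \<theta>))) \<partial>iid \<nu>) \<le> C"
  shows "(\<integral>\<^sup>+x. ennreal (exp (\<Sum>i<q. B (orbit a (i * L) (x, \<theta>)))) \<partial>iid \<nu>) \<le> C ^ q"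
proof (induction q arbitrary: \<theta>)
  case 0
  show ?case using prob_space.emeasure_space_1[OF prob_space_iid[OF \<nu>(1)]] by simp
next
  case (Suc q)
  interpret sequence_space \<nu>
    using \<nu>(1) unfolding sequence_space_def by (intro product_prob_spaceI)
  define G where "G = (\<lambda>z. ennreal (exp (\<Sum>i<q. B (orbit a (i * L) z))))"
  define A where "A = (\<lambda>z. ennreal (exp (B z)))"
  have cG: "continuous_on UNIV (\<lambda>z. exp (\<Sum>i<q. B (orbit a (i * L) z)))"
    by (intro continuous_intros continuous_on_compose2[OF B(1) continuous_on_orbit[OF a]]) auto
  have cA: "continuous_on UNIV (\<lambda>z. exp (B z))"
    by (intro continuous_intros B(1))
  have mG: "(\<lambda>x. G (x, \<theta>)) \<in> borel_measurable (iid \<nu>)" for \<theta>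
    unfolding G_def by (intro measurable_compose[OF measurable_iid_section[OF \<nu>(2) cG]]) simp
  have mA: "(\<lambda>x. A (x, \<theta>)) \<in> borel_measurable (iid \<nu>)" for \<theta>
    unfolding A_def by (intro measurable_compose[OF measurable_iid_section[OF \<nu>(2) cA]]) simp
  have mGo: "(\<lambda>x. G (orbit a L (x, \<theta>))) \<in> borel_measurable (iid \<nu>)" for \<theta>
    unfolding G_def
    by (intro measurable_compose[OF measurable_iid_section[OF \<nu>(2) continuous_on_compose2[OF cG continuous_on_orbit[OF a]]]]) auto
  have G_Suc: "ennreal (exp (\<Sum>i<Suc q. B (orbit a (i * L) z))) = A z * G (orbit a L z)" for z
    by (simp add: A_def G_def sum.lessThan_Suc_shift orbit_add exp_add ennreal_mult del: sum.lessThan_Suc)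
  have split: "A (comb_seq L u v, \<theta>) * G (orbit a L (comb_seq L u v, \<theta>))
      = A (u, \<theta>) * G (v, \<theta> + (\<Sum>i<L. a (u i)))" for u v
  proof -
    have "B (comb_seq L u v, \<theta>) = B (u, \<theta>)"
      using B(2) unfolding depends_below_def by (auto simp: comb_seq_less)
    moreover have "(\<Sum>i<L. a (comb_seq L u v i)) = (\<Sum>i<L. a (u i))"
      by (intro sum.cong) (auto simp: comb_seq_less)
    ultimately show ?thesis
      by (simp add: A_def orbit_def comb_seq_add)
  qed
  have meas: "(\<lambda>x. A (x, \<theta>) * G (orbit a L (x, \<theta>))) \<in> borel_measurable (iid \<nu>)"
    using mA mGo by (intro borel_measurable_times_ennreal)
  have "(\<integral>\<^sup>+x. ennreal (exp (\<Sum>i<Suc q. B (orbit a (i * L) (x, \<theta>)))) \<partial>iid \<nu>)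
      = (\<integral>\<^sup>+x. A (x, \<theta>) * G (orbit a L (x, \<theta>)) \<partial>distr (iid \<nu> \<Otimes>\<^sub>M iid \<nu>) (iid \<nu>) (\<lambda>(u, v). comb_seq L u v))"
    unfolding G_Suc unfolding iid_def PiM_comb_seq ..
  also have "\<dots> = (\<integral>\<^sup>+w. A (comb_seq L (fst w) (snd w), \<theta>) * G (orbit a L (comb_seq L (fst w) (snd w), \<theta>)) \<partial>(iid \<nu> \<Otimes>\<^sub>M iid \<nu>))"
    using meas measurable_comb_seq[of L \<nu>] unfolding iid_def
    by (subst nn_integral_distr) (auto simp: split_def)
  also have "\<dots> = (\<integral>\<^sup>+u. \<integral>\<^sup>+v. A (comb_seq L u v, \<theta>) * G (orbit a L (comb_seq L u v, \<theta>)) \<partial>iid \<nu> \<partial>iid \<nu>)"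
    using measurable_compose[OF measurable_comb_seq[of L \<nu>] meas[unfolded iid_def]] unfolding iid_def
    by (subst P.nn_integral_fst[symmetric]) (auto simp: split_def)
  also have "\<dots> = (\<integral>\<^sup>+u. A (u, \<theta>) * (\<integral>\<^sup>+v. G (v, \<theta> + (\<Sum>i<L. a (u i))) \<partial>iid \<nu>) \<partial>iid \<nu>)"
    unfolding split by (intro nn_integral_cong nn_integral_cmult mG)
  also have "\<dots> \<le> (\<integral>\<^sup>+u. A (u, \<theta>) * C ^ q \<partial>iid \<nu>)"
    using Suc.IH unfolding G_def by (intro nn_integral_mono mult_left_mono) auto
  also have "\<dots> = (\<integral>\<^sup>+u. A (u, \<theta>) \<partial>iid \<nu>) * C ^ q"
    by (intro nn_integral_multc mA)
  also have "\<dots> \<le> C * C ^ q"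
    using C unfolding A_def by (intro mult_right_mono) auto
  finally show ?case by simp
qed

lemma exp_le_quadratic:
  fixes b :: real
  assumes "\<bar>b\<bar> \<le> 1" shows "exp b \<le> 1 + b + b\<^sup>2"
proof (cases "b \<ge> 0")
  case True
  then show ?thesis using assms exp_bound[of b] by simp
next
  case False
  define c where "c = - b"
  have c: "0 \<le> c" "c \<le> 1" using False assms by (auto simp: c_def)
  have "exp b = 1 / exp c" by (simp add: c_def exp_minus field_simps)
  also have "\<dots> \<le> 1 / (1 + c)"
    using c exp_ge_add_one_self[of c] by (intro divide_left_mono) auto
  also have "\<dots> \<le> 1 - c + c\<^sup>2"
  proof -
    have "(1 - c + c\<^sup>2) * (1 + c) = 1 + c ^ 3" by (simp add: power2_eq_square power3_eq_cube algebra_simps)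
    moreover have "c ^ 3 \<ge> 0" using c by simp
    ultimately show ?thesis using c by (simp add: divide_le_eq)
  qed
  finally show ?thesis by (simp add: c_def)
qed

lemma sum_le_sum_blocks:
  fixes f :: "nat \<Rightarrow> real"
  assumes "\<And>j. f j \<le> K"
  shows "(\<Sum>j<q * (N + p) + s. f j) \<le> (\<Sum>i<q. \<Sum>j<N. f (i * (N + p) + j)) + real q * real p * K + real s * K"
proof -
  have "(\<Sum>j<q * (N + p). f j) \<le> (\<Sum>i<q. \<Sum>j<N. f (i * (N + p) + j)) + real q * real p * K"
  proof (induction q)
    case (Suc q)
    have "(\<Sum>j<Suc q * (N + p). f j) = (\<Sum>j<q * (N + p). f j) + (\<Sum>j<N + p. f (q * (N + p) + j))"
      using sum_lessThan_add[of f "q * (N + p)" "N + p"] by (simp add: add.commute)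
    also have "(\<Sum>j<N + p. f (q * (N + p) + j)) = (\<Sum>j<N. f (q * (N + p) + j)) + (\<Sum>j<p. f (q * (N + p) + (N + j)))"
      by (rule sum_lessThan_add)
    also have "(\<Sum>j<p. f (q * (N + p) + (N + j))) \<le> real p * K"
      using sum_bounded_above[of "{..<p}" "\<lambda>j. f (q * (N + p) + (N + j))" K] assms by simp
    finally show ?case using Suc.IH by (simp add: algebra_simps)
  qed simp
  moreover have "(\<Sum>j<s. f (q * (N + p) + j)) \<le> real s * K"
    using sum_bounded_above[of "{..<s}" "\<lambda>j. f (q * (N + p) + j)" K] assms by simp
  ultimately show ?thesis by (simp add: sum_lessThan_add)
qed

text \<open>Chernoff's bound for blocks of length \<open>N + p\<close>. The last \<open>p\<close> steps of each block and the incomplete last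
  block are estimated trivially; by the assumptions on \<open>N\<close> and \<open>n\<close> each of these losses is at most an
  eighth of \<open>n * \<epsilon>\<close>.\<close>

lemma large_deviation_upper:
  fixes a :: "'a::second_countable_topology \<Rightarrow> 't::topological_ab_group_add"
    and \<psi> :: "(nat \<Rightarrow> 'a) \<times> 't \<Rightarrow> real"
  assumes \<nu>: "prob_space \<nu>" "sets \<nu> = sets borel" and a: "continuous_on UNIV a"
    and \<psi>: "continuous_on UNIV \<psi>" "depends_below p \<psi>" "\<And>z. \<bar>\<psi> z\<bar> \<le> K"
    and \<epsilon>: "0 < \<epsilon>" "\<epsilon> \<le> K" and N: "0 < N" "8 * K * p \<le> N * \<epsilon>"
    and mean: "\<And>\<theta>. (\<integral>x. (\<Sum>j<N. \<psi> (orbit a j (x, \<theta>))) \<partial>iid \<nu>) \<le> N * \<epsilon> / 4"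
    and n: "8 * K * (N + p) \<le> n * \<epsilon>"
  shows "measure (iid \<nu>) {x. n * \<epsilon> \<le> (\<Sum>j<n. \<psi> (orbit a j (x, \<theta>)))} \<le> exp (- (\<epsilon>\<^sup>2 / (16 * N * K\<^sup>2)) * n)"
proof -
  interpret prob_space "iid \<nu>" using prob_space_iid[OF \<nu>(1)] .
  have K: "K > 0" using \<epsilon> by simp
  \<comment> \<open>This choice balances the linear and the quadratic term of the exponential: the bounds for the mean of
    a block and for its second moment both contribute \<open>t * N * \<epsilon> / 4\<close>.\<close>
  define t where "t = \<epsilon> / (4 * N * K\<^sup>2)"
  define L where "L = N + p"
  define q where "q = n div L"
  define B where "B = (\<lambda>z. t * (\<Sum>j<N. \<psi> (orbit a j z)))"
  have t: "t > 0" using \<epsilon> N K by (simp add: t_def)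
  have tNK: "t * N * K\<^sup>2 = \<epsilon> / 4" using N K by (simp add: t_def)
  have cs: "continuous_on UNIV (\<lambda>z. \<Sum>j<N. \<psi> (orbit a j z))" for N
    by (intro continuous_intros continuous_on_compose2[OF \<psi>(1) continuous_on_orbit[OF a]]) auto
  have cB: "continuous_on UNIV B"
    unfolding B_def by (intro continuous_intros cs)
  have dB: "depends_below L B"
    unfolding depends_below_def B_def
  proof (intro allI impI arg_cong[where f="\<lambda>s. t * s"] sum.cong refl)
    fix x y :: "nat \<Rightarrow> 'a" and \<theta> j assume eq: "\<forall>i<L. x i = y i" and "j \<in> {..<N}"
    then have "depends_below L (\<lambda>z. \<psi> (orbit a j z))"
      by (intro depends_below_orbit[OF \<psi>(2)]) (auto simp: L_def)
    then show "\<psi> (orbit a j (x, \<theta>)) = \<psi> (orbit a j (y, \<theta>))"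
      using eq unfolding depends_below_def by blast
  qed
  have sN: "\<bar>\<Sum>j<N. \<psi> (orbit a j z)\<bar> \<le> N * K" for z
    using sum_bounded_above[of "{..<N}" "\<lambda>j. \<bar>\<psi> (orbit a j z)\<bar>" K] \<psi>(3)
    by (intro order_trans[OF sum_abs]) simp
  have Bb: "\<bar>B z\<bar> \<le> t * (N * K)" for z
    unfolding B_def abs_mult using t sN[of z] by (simp add: mult_left_mono)
  have "t * (N * K) * K = \<epsilon> / 4" using tNK by (simp add: power2_eq_square mult.assoc)
  then have "t * (N * K) * K \<le> 1 * K" using \<epsilon> by linarith
  then have tb1: "t * (N * K) \<le> 1" using mult_le_cancel_right_pos[OF K] by blast
  have exp_block: "(\<integral>\<^sup>+x. ennreal (exp (B (x, \<theta>))) \<partial>iid \<nu>) \<le> ennreal (exp (t * N * \<epsilon> / 2))" for \<theta>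
  proof -
    have int: "integrable (iid \<nu>) (\<lambda>x. B (x, \<theta>))"
      by (rule integrable_iid_section[OF \<nu> cB, where K="t * (real N * K)"]) (simp add: Bb)
    have "(\<integral>\<^sup>+x. ennreal (exp (B (x, \<theta>))) \<partial>iid \<nu>)
        \<le> (\<integral>\<^sup>+x. ennreal (1 + B (x, \<theta>) + (t * (N * K))\<^sup>2) \<partial>iid \<nu>)"
    proof (intro nn_integral_mono ennreal_leI)
      fix x
      have "exp (B (x, \<theta>)) \<le> 1 + B (x, \<theta>) + (B (x, \<theta>))\<^sup>2"
        using Bb[of "(x, \<theta>)"] tb1 by (intro exp_le_quadratic) simp
      also have "(B (x, \<theta>))\<^sup>2 \<le> (t * (N * K))\<^sup>2"
        using Bb[of "(x, \<theta>)"] by (metis abs_ge_zero power2_abs power_mono)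
      finally show "exp (B (x, \<theta>)) \<le> 1 + B (x, \<theta>) + (t * (N * K))\<^sup>2" by simp
    qed
    also have "\<dots> = ennreal (\<integral>x. 1 + B (x, \<theta>) + (t * (N * K))\<^sup>2 \<partial>iid \<nu>)"
    proof (rule nn_integral_eq_integral)
      have "0 \<le> 1 + B z" for z using Bb[of z] tb1 by linarith
      then show "AE x in iid \<nu>. 0 \<le> 1 + B (x, \<theta>) + (t * (N * K))\<^sup>2" by simp
    qed (use int in simp)
    also have "(\<integral>x. 1 + B (x, \<theta>) + (t * (N * K))\<^sup>2 \<partial>iid \<nu>)
        = 1 + t * (\<integral>x. (\<Sum>j<N. \<psi> (orbit a j (x, \<theta>))) \<partial>iid \<nu>) + (t * (N * K))\<^sup>2"
      using int by (simp add: prob_space) (simp add: B_def)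
    also have "\<dots> \<le> 1 + t * (N * \<epsilon> / 4) + t * N * \<epsilon> / 4"
    proof -
      have "(t * (N * K))\<^sup>2 = (t * N) * (t * N * K\<^sup>2)" by (simp add: power2_eq_square)
      then have "(t * (N * K))\<^sup>2 = t * N * \<epsilon> / 4" by (simp add: tNK)
      moreover have "t * (\<integral>x. (\<Sum>j<N. \<psi> (orbit a j (x, \<theta>))) \<partial>iid \<nu>) \<le> t * (N * \<epsilon> / 4)"
        using mean[of \<theta>] t by (intro mult_left_mono) auto
      ultimately show ?thesis by linarith
    qed
    also have "\<dots> \<le> exp (t * N * \<epsilon> / 2)"
      using exp_ge_add_one_self[of "t * N * \<epsilon> / 2"] by (simp add: field_simps)
    finally show ?thesis by (simp add: ennreal_leI)
  qed
  define D where "D = (\<lambda>x. \<Sum>i<q. B (orbit a (i * L) (x, \<theta>)))"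
  have mD: "D \<in> borel_measurable (iid \<nu>)"
    unfolding D_def
    by (intro borel_measurable_sum measurable_iid_section[OF \<nu>(2), where \<psi>="\<lambda>z. B (orbit a _ z)"]
        continuous_on_compose2[OF cB continuous_on_orbit[OF a]]) auto
  have expD: "(\<integral>\<^sup>+x. ennreal (exp (D x)) \<partial>iid \<nu>) \<le> ennreal (exp (q * (t * N * \<epsilon> / 2)))"
    using exp_moment_blocks[OF \<nu> a cB dB exp_block, where q = q and \<theta> = \<theta>]
    unfolding exp_of_nat_mult D_def by (simp add: ennreal_power)
  have qN: "real q * N \<le> n"
  proof -
    have "q * N \<le> q * L" by (simp add: L_def)
    also have "\<dots> \<le> n" by (simp add: q_def)
    finally show ?thesis by (metis of_nat_le_iff of_nat_mult)
  qed
  define Z where "Z = {x. n * \<epsilon> \<le> (\<Sum>j<n. \<psi> (orbit a j (x, \<theta>)))}"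
  have "emeasure (iid \<nu>) Z \<le> emeasure (iid \<nu>) {x \<in> space (iid \<nu>). 1 \<le> ennreal (exp (- (3 / 4 * t * n * \<epsilon>))) * ennreal (exp (D x))}"
  proof (intro emeasure_mono subsetI)
    fix x assume "x \<in> Z"
    have "n = q * L + n mod L" by (simp add: q_def)
    then have "(\<Sum>j<n. \<psi> (orbit a j (x, \<theta>)))
        \<le> (\<Sum>i<q. \<Sum>j<N. \<psi> (orbit a (i * L + j) (x, \<theta>))) + real q * real p * K + real (n mod L) * K"
      using sum_le_sum_blocks[of "\<lambda>j. \<psi> (orbit a j (x, \<theta>))" K q N p "n mod L"] \<psi>(3)
      by (metis L_def abs_le_D1)
    moreover have "t * (\<Sum>i<q. \<Sum>j<N. \<psi> (orbit a (i * L + j) (x, \<theta>))) = D x"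
      by (simp add: D_def B_def sum_distrib_left orbit_add)
    moreover have "real q * real p * K \<le> n * \<epsilon> / 8"
    proof -
      have "real q * (8 * K * p) \<le> real q * (N * \<epsilon>)" using N(2) by (intro mult_left_mono) auto
      also have "\<dots> \<le> n * \<epsilon>" using mult_right_mono[OF qN, of \<epsilon>] \<epsilon> by (simp add: mult.assoc)
      finally show ?thesis by (simp add: algebra_simps)
    qed
    moreover have "real (n mod L) * K \<le> n * \<epsilon> / 8"
    proof -
      have "L > 0" using N by (simp add: L_def)
      then have "real (n mod L) * K \<le> real L * K" using K by (intro mult_right_mono) auto
      then show ?thesis using n by (simp add: L_def algebra_simps)
    qed
    moreover have "n * \<epsilon> \<le> (\<Sum>j<n. \<psi> (orbit a j (x, \<theta>)))" using \<open>x \<in> Z\<close> by (simp add: Z_def)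
    ultimately have "3 / 4 * (n * \<epsilon>) \<le> (\<Sum>i<q. \<Sum>j<N. \<psi> (orbit a (i * L + j) (x, \<theta>)))" by linarith
    then have "t * (3 / 4 * (n * \<epsilon>)) \<le> D x"
      using t \<open>t * _ = D x\<close> by (metis less_imp_le mult_left_mono)
    then have "1 \<le> exp (- (3 / 4 * t * n * \<epsilon>)) * exp (D x)"
      by (simp add: exp_add[symmetric] algebra_simps)
    then show "x \<in> {x \<in> space (iid \<nu>). 1 \<le> ennreal (exp (- (3 / 4 * t * n * \<epsilon>))) * ennreal (exp (D x))}"
      by (simp add: space_iid[OF \<nu>(2)] ennreal_mult[symmetric])
  qed (use mD in measurable)
  also have "\<dots> \<le> ennreal (exp (- (3 / 4 * t * n * \<epsilon>))) * (\<integral>\<^sup>+x. ennreal (exp (D x)) * indicator (space (iid \<nu>)) x \<partial>iid \<nu>)"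
    using mD by (intro nn_integral_Markov_inequality) auto
  also have "(\<integral>\<^sup>+x. ennreal (exp (D x)) * indicator (space (iid \<nu>)) x \<partial>iid \<nu>) = (\<integral>\<^sup>+x. ennreal (exp (D x)) \<partial>iid \<nu>)"
    by (intro nn_integral_cong) simp
  also have "ennreal (exp (- (3 / 4 * t * n * \<epsilon>))) * \<dots> \<le> ennreal (exp (- (3 / 4 * t * n * \<epsilon>))) * ennreal (exp (q * (t * N * \<epsilon> / 2)))"
    by (intro mult_left_mono expD) simp
  also have "\<dots> = ennreal (exp (q * (t * N * \<epsilon> / 2) - 3 / 4 * t * n * \<epsilon>))"
    by (simp add: ennreal_mult[symmetric] exp_add[symmetric] algebra_simps)
  also have "\<dots> \<le> ennreal (exp (- (t * \<epsilon> / 4) * n))"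
  proof -
    have "real q * N * (t * \<epsilon> / 2) \<le> n * (t * \<epsilon> / 2)"
      using qN t \<epsilon> by (intro mult_right_mono) auto
    then show ?thesis by (intro ennreal_leI) (simp add: algebra_simps)
  qed
  also have "t * \<epsilon> / 4 = \<epsilon>\<^sup>2 / (16 * N * K\<^sup>2)"
    by (simp add: t_def power2_eq_square)
  finally show ?thesis
    unfolding Z_def by (simp add: emeasure_eq_measure)
qed

section \<open>Ergodicity and the characters of the torus\<close>

definition group_character :: "('t::{topological_space, ab_group_add} \<Rightarrow> complex) \<Rightarrow> bool"
  where "group_character \<kappa> \<longleftrightarrow>
    continuous_on UNIV \<kappa> \<and> (\<forall>x y. \<kappa> (x + y) = \<kappa> x * \<kappa> y) \<and> (\<forall>x. norm (\<kappa> x) = 1)"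

lemma group_characterD:
  assumes "group_character \<kappa>"
  shows "continuous_on UNIV \<kappa>" "\<kappa> (x + y) = \<kappa> x * \<kappa> y" "norm (\<kappa> x) = 1"
  using assms by (auto simp: group_character_def)

lemma group_character_sum:
  fixes f :: "nat \<Rightarrow> 't::{topological_space, ab_group_add}"
  assumes "group_character \<kappa>"
  shows "\<kappa> (\<Sum>i<j. f i) = (\<Prod>i<j. \<kappa> (f i))"
proof (induction j)
  case 0
  have "\<kappa> 0 * \<kappa> 0 = \<kappa> 0 * 1"
    using group_characterD(2)[OF assms, of 0 0] by simp
  moreover have "\<kappa> 0 \<noteq> 0" using group_characterD(3)[OF assms, of 0] by auto
  ultimately show ?case by simp
qed (simp add: group_characterD(2)[OF assms])

lemma group_character_one: "group_character (\<lambda>_. 1)"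
  by (simp add: group_character_def)

lemma group_character_mult:
  "group_character \<kappa> \<Longrightarrow> group_character \<kappa>' \<Longrightarrow> group_character (\<lambda>x. \<kappa> x * \<kappa>' x)"
  by (auto simp: group_character_def norm_mult intro!: continuous_on_mult)

lemma group_character_cnj: "group_character \<kappa> \<Longrightarrow> group_character (\<lambda>x. cnj (\<kappa> x))"
  by (auto simp: group_character_def intro!: continuous_on_cnj)

lemma group_character_coordinate: "group_character (\<lambda>\<theta> :: circle ^ 'd. circle_char (\<theta> $ i))"
proof -
  have "continuous_on UNIV (\<lambda>\<theta> :: circle ^ 'd. \<theta> $ i)"
    unfolding continuous_on_def by (auto intro: tendsto_vec_nth tendsto_ident_at)
  from continuous_on_compose2[OF continuous_circle_char this] show ?thesis
    by (auto simp: group_character_def circle_char_add)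
qed

lemma torus_characters_separate:
  fixes \<theta> \<theta>' :: "circle ^ 'd"
  assumes "\<theta> \<noteq> \<theta>'"
  obtains \<kappa> :: "circle ^ 'd \<Rightarrow> complex" where "group_character \<kappa>" "\<kappa> \<theta> \<noteq> \<kappa> \<theta>'"
proof -
  obtain i where "\<theta> $ i \<noteq> \<theta>' $ i" using assms by (auto simp: vec_eq_iff)
  then have "circle_char (\<theta> $ i) \<noteq> circle_char (\<theta>' $ i)"
    using inj_circle_char by (auto dest: injD)
  then show thesis using that group_character_coordinate by blast
qed

lemma haar_probD:
  assumes "haar_prob m"
  shows "prob_space m" "sets m = sets borel" "space m = UNIV" "distr m m (\<lambda>x. g + x) = m"
  using assms sets_eq_imp_space_eq[of m borel] by (auto simp: haar_prob_def)

lemma integral_haar_translate: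
  fixes f :: "'t::topological_ab_group_add \<Rightarrow> 'b::{banach, second_countable_topology}"
  assumes m: "haar_prob m" and f: "f \<in> borel_measurable m"
  shows "(\<integral>x. f (x + g) \<partial>m) = (\<integral>x. f x \<partial>m)"
proof -
  have "(\<lambda>x. g + x) \<in> borel_measurable borel"
    by (intro borel_measurable_continuous_onI continuous_on_add continuous_on_const continuous_on_id)
  then have "(\<lambda>x. g + x) \<in> measurable m m"
    using haar_probD(2)[OF m] by (simp cong: measurable_cong_sets)
  then have "(\<integral>x. f x \<partial>distr m m (\<lambda>x. g + x)) = (\<integral>x. f (g + x) \<partial>m)"
    using f by (rule integral_distr)
  then show ?thesis using haar_probD(4)[OF m, of g] by (simp add: add.commute)
qed

lemma integrable_haar_character:
  assumes m: "haar_prob m" and \<kappa>: "group_character \<kappa>"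
  shows "integrable m \<kappa>"
proof -
  interpret prob_space m using haar_probD(1)[OF m] .
  show ?thesis
    using borel_measurable_continuous_onI[OF group_characterD(1)[OF \<kappa>]] haar_probD(2)[OF m] group_characterD(3)[OF \<kappa>]
    by (intro integrable_const_bound[where B=1]) (auto cong: measurable_cong_sets)
qed

text \<open>Translating by some \<open>g\<close> with \<open>\<kappa> g \<noteq> 1\<close> multiplies the integral by \<open>\<kappa> g\<close> without changing it.\<close>

lemma integral_haar_character:
  fixes \<kappa> :: "'t::topological_ab_group_add \<Rightarrow> complex"
  assumes m: "haar_prob m" and \<kappa>: "group_character \<kappa>" "\<kappa> \<noteq> (\<lambda>_. 1)"
  shows "(\<integral>x. \<kappa> x \<partial>m) = 0"
proof -
  obtain g where g: "\<kappa> g \<noteq> 1" using \<kappa>(2) by auto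
  have "(\<integral>x. \<kappa> x \<partial>m) = (\<integral>x. \<kappa> (x + g) \<partial>m)"
    using integral_haar_translate[OF m borel_measurable_integrable[OF integrable_haar_character[OF m \<kappa>(1)]]] by simp
  also have "\<dots> = (\<integral>x. \<kappa> x \<partial>m) * \<kappa> g"
    by (simp add: group_characterD(2)[OF \<kappa>(1)])
  finally show ?thesis using g by simp
qed

lemma space_bernoulli: "sets \<nu> = sets borel \<Longrightarrow> space (bernoulli \<nu>) = UNIV"
  using sets_eq_imp_space_eq[of \<nu> borel] by (simp add: bernoulli_def space_PiM)

lemma sets_bernoulli:
  fixes \<nu> :: "'a::second_countable_topology measure"
  assumes "sets \<nu> = sets borel" shows "sets (bernoulli \<nu>) = sets borel"
proof -
  have "sets (bernoulli \<nu>) = sets (Pi\<^sub>M UNIV (\<lambda>_ :: int. borel :: 'a measure))"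
    unfolding bernoulli_def by (rule sets_PiM_cong) (use assms in auto)
  then show ?thesis by (simp add: sets_PiM_equal_borel)
qed

lemma prob_space_bernoulli: "prob_space \<nu> \<Longrightarrow> prob_space (bernoulli \<nu>)"
  unfolding bernoulli_def by (rule prob_space_PiM)

text \<open>A function of mean zero that is almost surely positive or almost surely nonpositive vanishes almost
  surely.\<close>

lemma (in prob_space) AE_eq_0_if_zero_one:
  fixes u :: "'a \<Rightarrow> real"
  assumes u: "integrable M u" "integral\<^sup>L M u = 0"
    and zo: "prob {x \<in> space M. u x > 0} = 0 \<or> prob {x \<in> space M. u x > 0} = 1"
  shows "AE x in M. u x = 0"
proof -
  have sets: "{x \<in> space M. u x > 0} \<in> events" using u(1) by measurable
  from zo show ?thesis
  proof
    assume "prob {x \<in> space M. u x > 0} = 0"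
    then have "AE x in M. \<not> u x > 0"
      using sets by (intro AE_I[of _ _ "{x \<in> space M. u x > 0}"]) (auto simp: emeasure_eq_measure)
    then have "AE x in M. 0 \<le> - u x" by eventually_elim simp
    then have "AE x in M. - u x = 0"
      using u integral_nonneg_eq_0_iff_AE[of M "\<lambda>x. - u x"] by simp
    then show ?thesis by simp
  next
    assume "prob {x \<in> space M. u x > 0} = 1"
    then have "AE x in M. u x > 0" using prob_Collect_eq_1[OF sets] by simp
    then have "AE x in M. 0 \<le> u x" by eventually_elim simp
    then show ?thesis using u integral_nonneg_eq_0_iff_AE[of M u] by simp
  qed
qed

lemma AE_bernoulli_all:
  assumes "prob_space \<nu>" "AE x in \<nu>. P x"
  shows "AE \<omega> in bernoulli \<nu>. \<forall>n. P (\<omega> n)"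
  unfolding AE_all_countable
proof
  fix n :: int
  show "AE \<omega> in bernoulli \<nu>. P (\<omega> n)"
    unfolding bernoulli_def by (rule AE_PiM_component) (use assms in auto)
qed

text \<open>If the integral were \<open>1\<close>, then \<open>\<kappa> \<circ> a\<close> would be \<open>1\<close> almost surely, so \<open>\<kappa>\<close> as a function of the angle
  would be invariant under the skew product. Its half spaces \<open>{\<theta>. Re (c * \<kappa> \<theta>) > 0}\<close> would have
  measure \<open>0\<close> or \<open>1\<close>, which is impossible as \<open>\<kappa>\<close> has modulus one and, being nontrivial, mean zero.\<close>

lemma ergodic_imp_integral_character_neq_1:
  fixes a :: "'a::second_countable_topology \<Rightarrow> circle ^ 'd"
  assumes a: "continuous_on UNIV a" and m: "haar_prob m"
    and \<nu>: "prob_space \<nu>" "sets \<nu> = sets borel"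
    and erg: "ergodic (bernoulli \<nu> \<Otimes>\<^sub>M m) (skew a)"
    and \<kappa>: "group_character \<kappa>" "\<kappa> \<noteq> (\<lambda>_. 1)"
  shows "(\<integral>x. \<kappa> (a x) \<partial>\<nu>) \<noteq> 1"
proof
  assume one: "(\<integral>x. \<kappa> (a x) \<partial>\<nu>) = 1"
  interpret n: prob_space \<nu> by fact
  interpret b: prob_space "bernoulli \<nu>" by (rule prob_space_bernoulli) fact
  interpret m: prob_space m using haar_probD(1)[OF m] .
  interpret bm: pair_sigma_finite "bernoulli \<nu>" m ..
  have cont: "continuous_on UNIV (\<lambda>x. \<kappa> (a x))"
    by (rule continuous_on_compose2[OF group_characterD(1)[OF \<kappa>(1)] a]) simp
  then have meas: "(\<lambda>x. \<kappa> (a x)) \<in> borel_measurable \<nu>"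
    using borel_measurable_continuous_onI \<nu>(2) by (simp cong: measurable_cong_sets)
  have int: "integrable \<nu> (\<lambda>x. \<kappa> (a x))"
    using meas group_characterD(3)[OF \<kappa>(1)] by (intro n.integrable_const_bound[where B=1]) auto
  have "AE x in \<nu>. 1 - Re (\<kappa> (a x)) = 0"
  proof (subst integral_nonneg_eq_0_iff_AE[symmetric])
    show "AE x in \<nu>. 0 \<le> 1 - Re (\<kappa> (a x))"
      using complex_Re_le_cmod[of "\<kappa> _"] group_characterD(3)[OF \<kappa>(1)] by (auto intro!: AE_I2)
    show "(\<integral>x. 1 - Re (\<kappa> (a x)) \<partial>\<nu>) = 0"
      using int one by (simp add: n.prob_space)
  qed (use int in simp)
  then have inv: "AE x in \<nu>. \<kappa> (a x) = 1"
  proof eventually_elim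
    fix x assume "1 - Re (\<kappa> (a x)) = 0"
    then have re: "Re (\<kappa> (a x)) = 1" by simp
    have "(Re (\<kappa> (a x)))\<^sup>2 + (Im (\<kappa> (a x)))\<^sup>2 = 1"
      using group_characterD(3)[OF \<kappa>(1), of "a x"] by (metis cmod_power2 one_power2)
    then show "\<kappa> (a x) = 1" using re by (simp add: complex_eq_iff)
  qed
  \<comment> \<open>Ergodicity speaks of strictly invariant sets. Requiring \<open>\<kappa> (a (\<omega> n)) = 1\<close> for every \<open>n\<close>, not just
    for \<open>n = 0\<close>, makes the base set invariant under the shift at the price of countably many null sets.\<close>
  define X where "X = {\<omega> :: int \<Rightarrow> 'a. \<forall>n. \<kappa> (a (\<omega> n)) = 1}"
  have "(\<lambda>\<omega>. \<omega> n) \<in> measurable (bernoulli \<nu>) \<nu>" for n :: int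
    unfolding bernoulli_def by simp
  from measurable_compose[OF this meas]
  have [measurable]: "(\<lambda>\<omega>. \<kappa> (a (\<omega> n))) \<in> borel_measurable (bernoulli \<nu>)" for n :: int .
  have "{\<omega> \<in> space (bernoulli \<nu>). \<kappa> (a (\<omega> n)) = 1} \<in> sets (bernoulli \<nu>)" for n :: int
    by measurable
  then have "{\<omega> \<in> space (bernoulli \<nu>). \<forall>n. \<kappa> (a (\<omega> n)) = 1} \<in> sets (bernoulli \<nu>)"
    by (intro sets.sets_Collect_countable_All) auto
  then have X: "X \<in> sets (bernoulli \<nu>)" by (simp add: X_def space_bernoulli[OF \<nu>(2)])
  have X1: "measure (bernoulli \<nu>) X = 1"
    using AE_bernoulli_all[OF \<nu>(1) inv] X b.prob_eq_1 by (simp add: X_def)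
  have zero: "AE \<theta> in m. Re (c * \<kappa> \<theta>) = 0" for c
  proof (rule m.AE_eq_0_if_zero_one)
    show int: "integrable m (\<lambda>\<theta>. Re (c * \<kappa> \<theta>))"
      using integrable_haar_character[OF m \<kappa>(1)] by simp
    have "(\<integral>\<theta>. Re (c * \<kappa> \<theta>) \<partial>m) = Re (\<integral>\<theta>. c * \<kappa> \<theta> \<partial>m)"
      using integrable_haar_character[OF m \<kappa>(1)] by (intro integral_Re) simp
    then show "(\<integral>\<theta>. Re (c * \<kappa> \<theta>) \<partial>m) = 0"
      using integral_haar_character[OF m \<kappa>] by simp
    define Y where "Y = {\<theta> \<in> space m. 0 < Re (c * \<kappa> \<theta>)}"
    have Y: "Y \<in> sets m" unfolding Y_def using int by measurable
    have "X \<times> Y \<in> sets (bernoulli \<nu> \<Otimes>\<^sub>M m)" using X Y by simp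
    moreover have "skew a -` (X \<times> Y) \<inter> space (bernoulli \<nu> \<Otimes>\<^sub>M m) = X \<times> Y"
    proof -
      have "(shift \<omega>, \<theta> + a (\<omega> 0)) \<in> X \<times> Y \<longleftrightarrow> (\<omega>, \<theta>) \<in> X \<times> Y" for \<omega> \<theta>
      proof -
        have sh: "shift \<omega> \<in> X \<longleftrightarrow> \<omega> \<in> X"
        proof
          assume *: "shift \<omega> \<in> X"
          have "\<kappa> (a (\<omega> n)) = 1" for n
            using *[unfolded X_def shift_def, simplified, rule_format, of "n - 1"] by simp
          then show "\<omega> \<in> X" by (simp add: X_def)
        qed (simp add: X_def shift_def)
        have "\<theta> + a (\<omega> 0) \<in> Y \<longleftrightarrow> \<theta> \<in> Y" if "\<omega> \<in> X"
          using that by (simp add: X_def Y_def haar_probD(3)[OF m] group_characterD(2)[OF \<kappa>(1)])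
        with sh show ?thesis by auto
      qed
      then show ?thesis
        by (auto simp: skew_def space_pair_measure space_bernoulli[OF \<nu>(2)] haar_probD(3)[OF m] simp del: mem_Sigma_iff)
    qed
    ultimately have "measure (bernoulli \<nu> \<Otimes>\<^sub>M m) (X \<times> Y) = 0 \<or> measure (bernoulli \<nu> \<Otimes>\<^sub>M m) (X \<times> Y) = 1"
      using erg by (simp add: ergodic_def)
    moreover have "measure (bernoulli \<nu> \<Otimes>\<^sub>M m) (X \<times> Y) = measure m Y"
    proof (rule measure_eq_emeasure_eq_ennreal)
      show "emeasure (bernoulli \<nu> \<Otimes>\<^sub>M m) (X \<times> Y) = ennreal (measure m Y)"
        unfolding m.emeasure_pair_measure_Times[OF X Y] b.emeasure_eq_measure X1 m.emeasure_eq_measure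
        by simp
    qed simp
    ultimately show "m.prob {\<theta> \<in> space m. 0 < Re (c * \<kappa> \<theta>)} = 0 \<or> m.prob {\<theta> \<in> space m. 0 < Re (c * \<kappa> \<theta>)} = 1"
      by (simp add: Y_def)
  qed
  have "AE \<theta> in m. False"
    using zero[of 1] zero[of "- \<i>"]
  proof eventually_elim
    fix \<theta> assume "Re (1 * \<kappa> \<theta>) = 0" "Re (- \<i> * \<kappa> \<theta>) = 0"
    then have "\<kappa> \<theta> = 0" by (simp add: complex_eq_iff)
    then show False using group_characterD(3)[OF \<kappa>(1), of \<theta>] by simp
  qed
  then show False by simp
qed

section \<open>Approximation by trigonometric cylinder functions\<close>

text \<open>Finite sums of products of a cylinder function in the first \<open>p\<close> coordinates, itself a product, with a
  character of the group. The functions \<open>g i\<close> are complex-valued so that the class is closed under complex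
  conjugation and multiplication, while all expectations along orbits remain explicit.\<close>

inductive trig :: "nat \<Rightarrow> ((nat \<Rightarrow> 'a::metric_space) \<times> 't::topological_ab_group_add \<Rightarrow> complex) \<Rightarrow> bool"
  for p where
  monomial: "group_character \<kappa> \<Longrightarrow> (\<And>i. continuous_on UNIV (g i)) \<Longrightarrow> (\<And>i. bounded (range (g i))) \<Longrightarrow>
      trig p (\<lambda>z. c * (\<Prod>i<p. g i (fst z i)) * \<kappa> (snd z))"
| add: "trig p F \<Longrightarrow> trig p G \<Longrightarrow> trig p (\<lambda>z. F z + G z)"

lemma trig_const: "trig p (\<lambda>_. c)"
  using trig.monomial[OF group_character_one, of "\<lambda>_ _. 1" p c] by simp

lemma trig_cnj: "trig p F \<Longrightarrow> trig p (\<lambda>z. cnj (F z))"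
proof (induction rule: trig.induct)
  case (monomial \<kappa> g c)
  have "trig p (\<lambda>z. cnj c * (\<Prod>i<p. cnj (g i (fst z i))) * cnj (\<kappa> (snd z)))"
    using monomial
    by (intro trig.monomial[where g = "\<lambda>i x. cnj (g i x)"] group_character_cnj continuous_on_cnj) (auto simp: bounded_iff)
  then show ?case by (simp add: cnj_prod)
qed (auto intro: trig.add)

lemma trig_mult:
  assumes "trig p F" "trig p G" shows "trig p (\<lambda>z. F z * G z)"
  using assms(1)
proof induction
  case (monomial \<kappa> g c)
  note M = monomial
  show ?case
    using assms(2)
  proof induction
    case (monomial \<kappa>' g' c')
    have "bounded (range (\<lambda>x. g i x * g' i x))" for i
    proof -
      obtain A where "\<And>x. norm (g i x) \<le> A" using M(3)[of i] by (auto simp: bounded_iff)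
      moreover obtain B where "\<And>x. norm (g' i x) \<le> B" using monomial(3)[of i] by (auto simp: bounded_iff)
      ultimately have "norm (g i x * g' i x) \<le> A * B" for x
        unfolding norm_mult by (intro mult_mono order_trans[OF norm_ge_zero]) auto
      then show ?thesis by (auto simp: bounded_iff)
    qed
    then have "trig p (\<lambda>z. (c * c') * (\<Prod>i<p. g i (fst z i) * g' i (fst z i)) * (\<kappa> (snd z) * \<kappa>' (snd z)))"
      using M monomial
      by (intro trig.monomial[where g = "\<lambda>i x. g i x * g' i x" and \<kappa> = "\<lambda>x. \<kappa> x * \<kappa>' x"]
          group_character_mult continuous_on_mult) auto
    then show ?case by (simp add: prod.distrib mult_ac)
  next
    case (add F G)
    from trig.add[OF add.IH] show ?case by (simp add: distrib_left)
  qed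
next
  case (add F G)
  from trig.add[OF add.IH] show ?case by (simp add: distrib_right)
qed

lemma trig_continuous: "trig p F \<Longrightarrow> continuous_on UNIV F"
proof (induction rule: trig.induct)
  case (monomial \<kappa> g c)
  show ?case
    by (intro continuous_on_mult continuous_on_prod continuous_on_const
        continuous_on_compose2[OF monomial(2) continuous_on_fst_component]
        continuous_on_compose2[OF group_characterD(1)[OF monomial(1)] continuous_on_snd[OF continuous_on_id]]) auto
qed (rule continuous_on_add)

lemma trig_bounded: "trig p F \<Longrightarrow> bounded (range F)"
proof (induction rule: trig.induct)
  case (monomial \<kappa> g c)
  have "\<forall>i. \<exists>B. \<forall>x. norm (g i x) \<le> B"
    using monomial(3) by (auto simp: bounded_iff)
  from choice[OF this] obtain B where B: "\<And>i x. norm (g i x) \<le> B i" by blast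
  have "norm (c * (\<Prod>i<p. g i (fst z i)) * \<kappa> (snd z)) \<le> norm c * (\<Prod>i<p. B i)" for z
    unfolding norm_mult group_characterD(3)[OF monomial(1)] prod_norm[symmetric]
    using B by (auto intro!: mult_left_mono prod_mono)
  then show ?case by (intro boundedI[where B = "norm c * (\<Prod>i<p. B i)"]) auto
next
  case (add F G)
  then obtain A B where "\<And>z. norm (F z) \<le> A" "\<And>z. norm (G z) \<le> B" by (auto simp: bounded_iff)
  then have "norm (F z + G z) \<le> A + B" for z by (meson add_mono norm_triangle_le)
  then show ?case by (auto simp: bounded_iff)
qed

lemma trig_depends_below: "trig p F \<Longrightarrow> depends_below p F"
proof (induction rule: trig.induct)
  case (monomial \<kappa> g c)
  then show ?case by (auto simp: depends_below_def intro!: prod.cong)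
next
  case (add F G)
  then show ?case unfolding depends_below_def by metis
qed

lemma tendsto_funI:
  fixes f :: "'n \<Rightarrow> 'i \<Rightarrow> 'a::topological_space"
  assumes "\<And>i. ((\<lambda>n. f n i) \<longlongrightarrow> l i) F"
  shows "(f \<longlongrightarrow> l) F"
proof -
  have "limitin (product_topology (\<lambda>_. euclidean) UNIV) f l F"
    using assms by (simp add: limitin_componentwise)
  then have "limitin euclidean f l F"
    by (metis euclidean_product_topology)
  then show ?thesis by simp
qed

definition trig_real :: "nat \<Rightarrow> ((nat \<Rightarrow> 'a::metric_space) \<times> 't::topological_ab_group_add \<Rightarrow> real) set"
  where "trig_real p = {\<lambda>z. Re (G z) | G. trig p G}"

lemma Re_in_trig_real: "trig p G \<Longrightarrow> (\<lambda>z. Re (G z)) \<in> trig_real p"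
  unfolding trig_real_def by blast

text \<open>The product of two real parts is again a real part because
  \<open>Re u * Re v = Re (u * (v + cnj v) / 2)\<close>. Angles are separated by characters, sequences by the
  truncated distance to one of their entries.\<close>

lemma function_ring_Re_trig:
  fixes S :: "((nat \<Rightarrow> 'a::metric_space) \<times> 't::{topological_ab_group_add, t2_space}) set"
  assumes compact: "compact S"
    and char: "\<And>\<theta> \<theta>' :: 't. \<theta> \<noteq> \<theta>' \<Longrightarrow> \<exists>\<kappa>. group_character \<kappa> \<and> \<kappa> \<theta> \<noteq> \<kappa> \<theta>'"
    and coord: "\<And>x y \<theta> \<theta>'. (x, \<theta>) \<in> S \<Longrightarrow> (y, \<theta>') \<in> S \<Longrightarrow> x \<noteq> y \<Longrightarrow> \<exists>i<p. x i \<noteq> y i"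
  shows "function_ring_on (trig_real p) S"
proof unfold_locales
  fix f :: "(nat \<Rightarrow> 'a) \<times> 't \<Rightarrow> real" assume "f \<in> trig_real p"
  then show "continuous_on S f"
    by (auto simp: trig_real_def intro!: continuous_on_Re continuous_on_subset[OF trig_continuous])
next
  fix f g :: "(nat \<Rightarrow> 'a) \<times> 't \<Rightarrow> real" assume "f \<in> trig_real p"
    "g \<in> trig_real p"
  then obtain F G where FG: "trig p F" "trig p G" "f = (\<lambda>z. Re (F z))" "g = (\<lambda>z. Re (G z))"
    unfolding trig_real_def by blast
  show "(\<lambda>z. f z + g z) \<in> trig_real p"
    using Re_in_trig_real[OF trig.add[OF FG(1,2)]] by (simp add: FG)
  have "trig p (\<lambda>z. F z * ((G z + cnj (G z)) * (1 / 2)))"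
    by (intro trig_mult trig.add trig_cnj FG trig_const)
  from Re_in_trig_real[OF this]
  have "(\<lambda>z. Re (F z * ((G z + cnj (G z)) * (1 / 2)))) \<in> trig_real p" .
  moreover have "Re (F z * ((G z + cnj (G z)) * (1 / 2))) = f z * g z" for z
    by (simp add: FG complex_add_cnj)
  ultimately show "(\<lambda>z. f z * g z) \<in> trig_real p"
    by simp
next
  fix c :: real
  show "(\<lambda>_. c) \<in> trig_real p"
    using Re_in_trig_real[OF trig_const[of p "complex_of_real c"]] by simp
next
  fix z w assume S: "z \<in> S" "w \<in> S" and "z \<noteq> w"
  obtain x \<theta> y \<theta>' where zw: "z = (x, \<theta>)" "w = (y, \<theta>')" by fastforce
  have "\<exists>G. trig p G \<and> G z \<noteq> G w"
  proof (cases "\<theta> = \<theta>'")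
    case True
    then obtain i where i: "i < p" "x i \<noteq> y i" using coord S zw \<open>z \<noteq> w\<close> by blast
    define g where "g = (\<lambda>j u. if j = i then complex_of_real (min 1 (dist (x i) u)) else 1)"
    have "trig p (\<lambda>z :: (nat \<Rightarrow> 'a) \<times> 't. 1 * (\<Prod>j<p. g j (fst z j)) * 1)"
    proof (rule trig.monomial[OF group_character_one])
      fix j
      show "continuous_on UNIV (g j)"
        unfolding g_def by (cases "j = i") (auto intro!: continuous_intros)
      have "norm (g j u) \<le> 1" for u by (simp add: g_def)
      then show "bounded (range (g j))" by (auto simp: bounded_iff)
    qed
    moreover have "(\<Prod>j<p. g j (v j)) = complex_of_real (min 1 (dist (x i) (v i)))" for v
    proof -
      have "(\<Prod>j<p. g j (v j)) = (\<Prod>j<p. if j = i then complex_of_real (min 1 (dist (x i) (v i))) else 1)"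
        by (intro prod.cong) (auto simp: g_def)
      then show ?thesis using i by simp
    qed
    ultimately have "trig p (\<lambda>z :: (nat \<Rightarrow> 'a) \<times> 't. complex_of_real (min 1 (dist (x i) (fst z i))))" by simp
    moreover have "min 1 (dist (x i) (y i)) \<noteq> 0" using i by (simp add: min_def)
    ultimately show ?thesis
      by (intro exI[of _ "\<lambda>z. complex_of_real (min 1 (dist (x i) (fst z i)))"]) (simp add: zw)
  next
    case False
    then obtain \<kappa> where \<kappa>: "group_character \<kappa>" "\<kappa> \<theta> \<noteq> \<kappa> \<theta>'" using char by blast
    have "trig p (\<lambda>z :: (nat \<Rightarrow> 'a) \<times> 't. 1 * (\<Prod>j<p. 1) * \<kappa> (snd z))"
      by (rule trig.monomial[OF \<kappa>(1), where g = "\<lambda>_ _. 1"]) auto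
    then show ?thesis
      using \<kappa>(2) by (intro exI[of _ "\<lambda>z. \<kappa> (snd z)"]) (auto simp: zw)
  qed
  then obtain G where G: "trig p G" "G z \<noteq> G w" by blast
  have iG: "trig p (\<lambda>z. - \<i> * G z)" by (intro trig_mult trig_const G)
  show "\<exists>f\<in>trig_real p. f z \<noteq> f w"
  proof (cases "Re (G z) = Re (G w)")
    case True
    then have "Re (- \<i> * G z) \<noteq> Re (- \<i> * G w)" using G(2) by (simp add: complex_eq_iff)
    moreover have "(\<lambda>z. Re (- \<i> * G z)) \<in> trig_real p"
      by (rule Re_in_trig_real[OF iG])
    ultimately show ?thesis by (intro bexI)
  next
    case False
    then show ?thesis using Re_in_trig_real[OF G(1)] by (intro bexI)
  qed
qed (rule compact)

text \<open>On sequences with the first \<open>p\<close> entries in \<open>K\<close> this is the Stone-Weierstrass theorem. The estimate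
  extends to a uniform neighbourhood by compactness: a sequence of counterexamples ever closer to \<open>K\<close> would
  accumulate at a point over \<open>K\<close> where the estimate fails.\<close>

lemma trig_approximation:
  fixes \<psi> :: "(nat \<Rightarrow> 'a::{metric_space, second_countable_topology}) \<times> 't::{topological_ab_group_add, t2_space, second_countable_topology} \<Rightarrow> real"
  assumes comp: "compact (UNIV :: 't set)"
    and char: "\<And>\<theta> \<theta>' :: 't. \<theta> \<noteq> \<theta>' \<Longrightarrow> \<exists>\<kappa>. group_character \<kappa> \<and> \<kappa> \<theta> \<noteq> \<kappa> \<theta>'"
    and K: "compact K" "K \<noteq> {}"
    and \<psi>: "continuous_on UNIV \<psi>" "depends_below p \<psi>" and "\<eta> > 0"
  obtains G r where "trig p G" "r > 0"
    "\<And>x \<theta>. (\<forall>i<p. infdist (x i) K < r) \<Longrightarrow> \<bar>\<psi> (x, \<theta>) - Re (G (x, \<theta>))\<bar> < \<eta>"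
proof -
  obtain z0 where "z0 \<in> K" using K(2) by blast
  \<comment> \<open>Freezing the remaining entries at one point makes the domain compact and lets the first \<open>p\<close> coordinates
    separate its points; both functions ignore those entries.\<close>
  define S where "S = Pi UNIV (\<lambda>i. if i < p then K else {z0}) \<times> (UNIV :: 't set)"
  have "compact S"
    unfolding S_def by (intro compact_Times comp compact_Pi_UNIV) (use K in auto)
  interpret function_ring_on "trig_real p" S
  proof (rule function_ring_Re_trig[OF \<open>compact S\<close> char])
    fix x y and \<theta> \<theta>' :: 't assume xy: "(x, \<theta>) \<in> S" "(y, \<theta>') \<in> S" "x \<noteq> y"
    then obtain i where "x i \<noteq> y i" by blast
    moreover from this have "i < p" using xy by (auto simp: S_def Pi_iff split: if_splits)
    ultimately show "\<exists>i<p. x i \<noteq> y i" by blast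
  qed
  obtain G where G: "trig p G" "\<And>z. z \<in> S \<Longrightarrow> \<bar>\<psi> z - Re (G z)\<bar> < \<eta>"
    using Stone_Weierstrass_basic[OF continuous_on_subset[OF \<psi>(1)] \<open>\<eta> > 0\<close>]
    unfolding trig_real_def by blast
  have "\<exists>n. \<forall>x \<theta>. (\<forall>i<p. infdist (x i) K < 1 / real (Suc n)) \<longrightarrow> \<bar>\<psi> (x, \<theta>) - Re (G (x, \<theta>))\<bar> < \<eta>"
  proof (rule ccontr)
    assume "\<not> ?thesis"
    then have "\<forall>n. \<exists>x \<theta>. (\<forall>i<p. infdist (x i) K < 1 / real (Suc n)) \<and> \<not> \<bar>\<psi> (x, \<theta>) - Re (G (x, \<theta>))\<bar> < \<eta>"
      by blast
    from choice[OF this] obtain x where "\<forall>n. \<exists>\<theta>. (\<forall>i<p. infdist (x n i) K < 1 / real (Suc n)) \<and>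
        \<not> \<bar>\<psi> (x n, \<theta>) - Re (G (x n, \<theta>))\<bar> < \<eta>" ..
    from choice[OF this] obtain \<theta> where x_all: "\<forall>n. (\<forall>i<p. infdist (x n i) K < 1 / real (Suc n)) \<and>
        \<not> \<bar>\<psi> (x n, \<theta> n) - Re (G (x n, \<theta> n))\<bar> < \<eta>" ..
    have x: "infdist (x n i) K < 1 / real (Suc n)" if "i < p" for n i
      using x_all[THEN spec, THEN conjunct1] that by blast
    have x': "\<not> \<bar>\<psi> (x n, \<theta> n) - Re (G (x n, \<theta> n))\<bar> < \<eta>" for n
      by (rule x_all[THEN spec, THEN conjunct2])
    define w where "w = (\<lambda>n i. if i < p then x n i else z0)"
    have w: "\<not> \<bar>\<psi> (w n, \<theta> n) - Re (G (w n, \<theta> n))\<bar> < \<eta>" for n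
    proof -
      have eq: "\<forall>i<p. w n i = x n i" by (simp add: w_def)
      have "\<psi> (w n, \<theta> n) = \<psi> (x n, \<theta> n)"
        using \<psi>(2) eq unfolding depends_below_def by blast
      moreover have "G (w n, \<theta> n) = G (x n, \<theta> n)"
        using trig_depends_below[OF G(1)] eq unfolding depends_below_def by blast
      ultimately show ?thesis using x'[of n] by (simp only: simp_thms)
    qed
    have "\<exists>k\<in>K. dist (w n i) k < 1 / real (Suc n)" for n i
    proof (cases "i < p")
      case True
      then have "(INF a\<in>K. dist (w n i) a) < 1 / real (Suc n)"
        using x[OF True, of n] K(2) by (simp add: infdist_notempty w_def)
      then show ?thesis
        using K(2) by (subst (asm) cINF_less_iff) (auto intro: bdd_belowI2[of _ 0])
    qed (use \<open>z0 \<in> K\<close> in \<open>auto simp: w_def intro!: bexI[of _ z0]\<close>)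
    then have "\<forall>n. \<exists>k. \<forall>i. k i \<in> K \<and> dist (w n i) (k i) < 1 / real (Suc n)"
      by (intro allI choice) blast
    from choice[OF this] obtain k where k_all: "\<forall>n. \<forall>i. k n i \<in> K \<and> dist (w n i) (k n i) < 1 / real (Suc n)" ..
    have k: "k n i \<in> K" "dist (w n i) (k n i) < 1 / real (Suc n)" for n i
      by (rule k_all[THEN spec, THEN spec, THEN conjunct1], rule k_all[THEN spec, THEN spec, THEN conjunct2])
    define y where "y = (\<lambda>n i. if i < p then k n i else z0)"
    have "\<forall>n. (y n, \<theta> n) \<in> S" using k(1) by (auto simp: S_def y_def)
    from seq_compactE[OF compact_imp_seq_compact[OF \<open>compact S\<close>] this]
    obtain l s where s: "l \<in> S" "strict_mono s" "((\<lambda>n. (y n, \<theta> n)) \<circ> s) \<longlonglongrightarrow> l" .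
    have yl: "(\<lambda>n. y (s n)) \<longlonglongrightarrow> fst l" and \<theta>l: "(\<lambda>n. \<theta> (s n)) \<longlonglongrightarrow> snd l"
      using tendsto_fst[OF s(3)] tendsto_snd[OF s(3)] by (simp_all add: o_def)
    have "(\<lambda>n. w (s n)) \<longlonglongrightarrow> fst l"
    proof (rule tendsto_funI)
      fix i
      have "(\<lambda>n. dist (w n i) (y n i)) \<longlonglongrightarrow> 0"
      proof (rule tendsto_sandwich[OF _ _ tendsto_const LIMSEQ_inverse_real_of_nat])
        show "\<forall>\<^sub>F n in sequentially. dist (w n i) (y n i) \<le> inverse (real (Suc n))"
          using k(2)[of _ i] by (auto simp: w_def y_def inverse_eq_divide less_imp_le intro!: always_eventually)
      qed simp
      then have "(\<lambda>n. dist (w (s n) i) (y (s n) i)) \<longlonglongrightarrow> 0"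
        using LIMSEQ_subseq_LIMSEQ[OF _ s(2)] by (fastforce simp: o_def)
      moreover have "(\<lambda>n. y (s n) i) \<longlonglongrightarrow> fst l i"
        using continuous_on_tendsto_compose[OF continuous_on_product_coordinates yl] by simp
      ultimately have "(\<lambda>n. dist (w (s n) i) (y (s n) i) + dist (y (s n) i) (fst l i)) \<longlonglongrightarrow> 0 + 0"
        by (intro tendsto_add) (simp_all add: tendsto_dist_iff[symmetric])
      then have up: "(\<lambda>n. dist (w (s n) i) (y (s n) i) + dist (y (s n) i) (fst l i)) \<longlonglongrightarrow> 0" by simp
      have "(\<lambda>n. dist (w (s n) i) (fst l i)) \<longlonglongrightarrow> 0"
        by (rule tendsto_sandwich[OF _ _ tendsto_const up]) (intro always_eventually allI zero_le_dist dist_triangle)+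
      then show "(\<lambda>n. w (s n) i) \<longlonglongrightarrow> fst l i"
        by (rule tendsto_dist_iff[THEN iffD2])
    qed
    from tendsto_Pair[OF this \<theta>l] have lim: "(\<lambda>n. (w (s n), \<theta> (s n))) \<longlonglongrightarrow> l" by simp
    have "continuous_on UNIV (\<lambda>z. \<bar>\<psi> z - Re (G z)\<bar>)"
      by (intro continuous_intros \<psi> trig_continuous[OF G(1)])
    from continuous_on_tendsto_compose[OF this lim]
    have "(\<lambda>n. \<bar>\<psi> (w (s n), \<theta> (s n)) - Re (G (w (s n), \<theta> (s n)))\<bar>) \<longlonglongrightarrow> \<bar>\<psi> l - Re (G l)\<bar>" by simp
    then have "\<eta> \<le> \<bar>\<psi> l - Re (G l)\<bar>"
      using w by (intro LIMSEQ_le_const[of _ _ \<eta>]) (auto simp: not_less)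
    then show False using G(2)[OF s(1)] by simp
  qed
  then obtain n where n: "\<forall>x \<theta>. (\<forall>i<p. infdist (x i) K < 1 / real (Suc n)) \<longrightarrow> \<bar>\<psi> (x, \<theta>) - Re (G (x, \<theta>))\<bar> < \<eta>" ..
  show thesis
  proof (rule that[OF G(1)])
    show "0 < 1 / real (Suc n)" by simp
    show "\<bar>\<psi> (x, \<theta>) - Re (G (x, \<theta>))\<bar> < \<eta>" if "\<forall>i<p. infdist (x i) K < 1 / real (Suc n)" for x \<theta>
      using n[THEN spec, THEN spec, THEN mp, OF that] .
  qed
qed

section \<open>Uniform convergence of block averages\<close>

lemma prod_lessThan_add:
  fixes f :: "nat \<Rightarrow> 'a::comm_monoid_mult"
  shows "(\<Prod>j<m + k. f j) = (\<Prod>j<m. f j) * (\<Prod>j<k. f (m + j))"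
  by (induction k) (auto simp: mult.assoc)

text \<open>Along the orbit, \<open>\<kappa>\<close> turns the accumulated angle into a product over the first \<open>j\<close> entries, while the
  cylinder function reads the next \<open>p\<close> entries; by independence the expectation factorizes.\<close>

lemma integral_monomial_orbit:
  fixes a :: "'a::{metric_space, second_countable_topology} \<Rightarrow> 't::topological_ab_group_add"
  assumes \<nu>: "prob_space \<nu>" "sets \<nu> = sets borel" and a: "continuous_on UNIV a"
    and \<kappa>: "group_character \<kappa>" and g: "\<And>i. continuous_on UNIV (g i)" "\<And>i. bounded (range (g i))"
  shows "(\<integral>x. c * (\<Prod>i<p. g i (fst (orbit a j (x, \<theta>)) i)) * \<kappa> (snd (orbit a j (x, \<theta>))) \<partial>iid \<nu>)
    = c * (\<Prod>i<p. \<integral>x. g i x \<partial>\<nu>) * (\<integral>x. \<kappa> (a x) \<partial>\<nu>) ^ j * \<kappa> \<theta>"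
proof -
  define F where "F = (\<lambda>z. c * (\<Prod>i<p. g i (fst z i)) * \<kappa> (snd z))"
  define h where "h = (\<lambda>i. if i < j then (\<lambda>x. \<kappa> (a x)) else g (i - j))"
  have "bounded (range (\<lambda>x. \<kappa> (a x)))"
    by (auto simp: bounded_iff group_characterD(3)[OF \<kappa>] intro!: exI[of _ 1])
  moreover have "continuous_on UNIV (\<lambda>x. \<kappa> (a x))"
    by (rule continuous_on_compose2[OF group_characterD(1)[OF \<kappa>] a]) simp
  ultimately have int: "integrable \<nu> (h i)" for i
    unfolding h_def using g by (auto intro!: continuous_bounded_integrable[OF \<nu>])
  have "F (orbit a j (x, \<theta>)) = (c * \<kappa> \<theta>) * (\<Prod>i<j + p. h i (x i))" for x
    unfolding prod_lessThan_add
    by (simp add: F_def orbit_def h_def group_characterD(2)[OF \<kappa>] group_character_sum[OF \<kappa>] add.commute)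
  then have "(\<integral>x. F (orbit a j (x, \<theta>)) \<partial>iid \<nu>) = (c * \<kappa> \<theta>) * (\<Prod>i<j + p. \<integral>x. h i x \<partial>\<nu>)"
    by (simp add: integral_iid_prod[OF \<nu>(1) int])
  also have "(\<Prod>i<j + p. \<integral>x. h i x \<partial>\<nu>) = (\<integral>x. \<kappa> (a x) \<partial>\<nu>) ^ j * (\<Prod>i<p. \<integral>x. g i x \<partial>\<nu>)"
    unfolding prod_lessThan_add by (simp add: h_def)
  finally show ?thesis by (simp add: F_def mult_ac)
qed

definition block_average :: "'a measure \<Rightarrow> ('a \<Rightarrow> 't::ab_group_add) \<Rightarrow> nat
    \<Rightarrow> ((nat \<Rightarrow> 'a) \<times> 't \<Rightarrow> 'b::{banach, second_countable_topology}) \<Rightarrow> 't \<Rightarrow> 'b"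
  where "block_average \<nu> a N \<psi> \<theta> = (\<Sum>j<N. \<integral>x. \<psi> (orbit a j (x, \<theta>)) \<partial>iid \<nu>) /\<^sub>R real N"

text \<open>The geometric sum is bounded by \<open>2 / norm (w - 1)\<close> for every length.\<close>

lemma averaged_powers_tendsto_0:
  fixes w :: complex
  assumes "norm w \<le> 1" "w \<noteq> 1"
  shows "(\<lambda>N. (\<Sum>j<N. w ^ j) /\<^sub>R real N) \<longlonglongrightarrow> 0"
proof (rule tendsto_norm_zero_cancel)
  have bound: "norm (\<Sum>j<N. w ^ j) \<le> 2 / norm (w - 1)" for N
  proof -
    have "norm (\<Sum>j<N. w ^ j) = norm (w ^ N - 1) / norm (w - 1)"
      using assms(2) by (simp add: geometric_sum norm_divide)
    moreover have "norm (w ^ N - 1) \<le> 2"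
      using assms(1) norm_triangle_ineq4[of "w ^ N" 1] power_le_one[of "norm w" N] by (simp add: norm_power)
    ultimately show ?thesis by (simp add: divide_right_mono)
  qed
  have "(\<lambda>N. 2 / norm (w - 1) * inverse (real N)) \<longlonglongrightarrow> 2 / norm (w - 1) * 0"
    by (intro tendsto_mult tendsto_const lim_inverse_n)
  then have up: "(\<lambda>N. 2 / norm (w - 1) * inverse (real N)) \<longlonglongrightarrow> 0" by simp
  have "norm ((\<Sum>j<N. w ^ j) /\<^sub>R real N) \<le> 2 / norm (w - 1) * inverse (real N)" for N
  proof -
    have "norm ((\<Sum>j<N. w ^ j) /\<^sub>R real N) = norm (\<Sum>j<N. w ^ j) * inverse (real N)" by simp
    then show ?thesis using mult_right_mono[OF bound[of N], of "inverse (real N)"] by (simp add: mult.commute)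
  qed
  then show "(\<lambda>N. norm ((\<Sum>j<N. w ^ j) /\<^sub>R real N)) \<longlonglongrightarrow> 0"
    by (intro tendsto_sandwich[OF _ _ tendsto_const up] always_eventually allI norm_ge_zero)
qed

text \<open>For the trivial character the block averages do not depend on the (positive) block length, and they converge
  as \<open>\<nu>\<close> approaches \<open>\<nu>\<^sub>0\<close>. For any other character, first the block length makes the average small for
  \<open>\<nu>\<^sub>0\<close>, and then, for that length, continuity in the measure makes it small near \<open>\<nu>\<^sub>0\<close>; this
  explains the order of the two quantifiers. The angle enters through a factor of modulus one.\<close>

lemma trig_block_average:
  fixes a :: "'a::{metric_space, second_countable_topology} \<Rightarrow> 't::topological_ab_group_add"
  assumes \<nu>\<^sub>0: "\<nu>\<^sub>0 \<in> Prob_c" and a: "continuous_on UNIV a"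
    and erg: "\<And>\<kappa> :: 't \<Rightarrow> complex. group_character \<kappa> \<Longrightarrow> \<kappa> \<noteq> (\<lambda>_. 1) \<Longrightarrow> (\<integral>x. \<kappa> (a x) \<partial>\<nu>\<^sub>0) \<noteq> 1"
    and F: "trig p F"
  shows "\<exists>z. \<forall>\<eta>>0. \<forall>\<^sub>F N in sequentially. \<forall>\<^sub>F \<nu> in W1_nhds \<nu>\<^sub>0. \<forall>\<theta>. norm (block_average \<nu> a N F \<theta> - z) \<le> \<eta>"
  using F
proof induction
  case (monomial \<kappa> g c)
  define V where "V = (\<lambda>\<nu>. c * (\<Prod>i<p. \<integral>x. g i x \<partial>\<nu>))"
  define W where "W = (\<lambda>\<nu>. \<integral>x. \<kappa> (a x) \<partial>\<nu>)"
  have avg: "block_average \<nu> a N (\<lambda>z. c * (\<Prod>i<p. g i (fst z i)) * \<kappa> (snd z)) \<theta>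
      = V \<nu> * ((\<Sum>j<N. W \<nu> ^ j) /\<^sub>R real N) * \<kappa> \<theta>" if "\<nu> \<in> Prob_c" for \<nu> N \<theta>
    unfolding block_average_def integral_monomial_orbit[OF Prob_cD(1,2)[OF that] a monomial]
    by (simp add: V_def W_def sum_distrib_left sum_distrib_right mult_ac)
  have V: "(V \<longlongrightarrow> V \<nu>\<^sub>0) (W1_nhds \<nu>\<^sub>0)"
    unfolding V_def
    by (intro tendsto_mult tendsto_const tendsto_prod tendsto_integral_W1_nhds[OF \<nu>\<^sub>0] monomial)
  have ka: "continuous_on UNIV (\<lambda>x. \<kappa> (a x))" "bounded (range (\<lambda>x. \<kappa> (a x)))"
    by (rule continuous_on_compose2[OF group_characterD(1)[OF monomial(1)] a])
       (auto simp: bounded_iff group_characterD(3)[OF monomial(1)] intro!: exI[of _ 1])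
  show ?case
  proof (cases "\<kappa> = (\<lambda>_. 1)")
    case True
    have "\<forall>\<^sub>F N in sequentially. \<forall>\<^sub>F \<nu> in W1_nhds \<nu>\<^sub>0. \<forall>\<theta>.
        norm (block_average \<nu> a N (\<lambda>z. c * (\<Prod>i<p. g i (fst z i)) * \<kappa> (snd z)) \<theta> - V \<nu>\<^sub>0) \<le> \<eta>" if "\<eta> > 0" for \<eta>
      using eventually_gt_at_top[of 0]
    proof eventually_elim
      case N: (elim N)
      from tendstoD[OF V \<open>\<eta> > 0\<close>] eventually_Prob_c
      show ?case
      proof eventually_elim
        case (elim \<nu>)
        have "W \<nu> = 1"
          using True by (simp add: W_def prob_space.prob_space[OF Prob_cD(1)[OF elim(2)]])
        then have "(\<Sum>j<N. W \<nu> ^ j) /\<^sub>R real N = 1"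
          using N by (simp add: scaleR_conv_of_real)
        then show ?case
          unfolding avg[OF elim(2)] using elim(1) True by (simp add: dist_norm less_imp_le)
      qed
    qed
    then show ?thesis by blast
  next
    case False
    interpret n0: prob_space \<nu>\<^sub>0 using Prob_cD(1)[OF \<nu>\<^sub>0] .
    have "norm (W \<nu>\<^sub>0) \<le> (\<integral>x. norm (\<kappa> (a x)) \<partial>\<nu>\<^sub>0)"
      unfolding W_def by (rule integral_norm_bound)
    then have "norm (W \<nu>\<^sub>0) \<le> 1"
      by (simp add: group_characterD(3)[OF monomial(1)] n0.prob_space)
    moreover have "W \<nu>\<^sub>0 \<noteq> 1" unfolding W_def using erg[OF monomial(1) False] .
    ultimately have lim: "(\<lambda>N. V \<nu>\<^sub>0 * ((\<Sum>j<N. W \<nu>\<^sub>0 ^ j) /\<^sub>R real N)) \<longlonglongrightarrow> V \<nu>\<^sub>0 * 0"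
      by (intro tendsto_mult tendsto_const averaged_powers_tendsto_0)
    have W: "(W \<longlongrightarrow> W \<nu>\<^sub>0) (W1_nhds \<nu>\<^sub>0)"
      unfolding W_def by (rule tendsto_integral_W1_nhds[OF \<nu>\<^sub>0 ka])
    have "\<forall>\<^sub>F N in sequentially. \<forall>\<^sub>F \<nu> in W1_nhds \<nu>\<^sub>0. \<forall>\<theta>.
        norm (block_average \<nu> a N (\<lambda>z. c * (\<Prod>i<p. g i (fst z i)) * \<kappa> (snd z)) \<theta> - 0) \<le> \<eta>" if "\<eta> > 0" for \<eta>
      using tendstoD[OF lim \<open>\<eta> > 0\<close>]
    proof eventually_elim
      case (elim N)
      have "((\<lambda>\<nu>. norm (V \<nu> * ((\<Sum>j<N. W \<nu> ^ j) /\<^sub>R real N)))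
          \<longlongrightarrow> norm (V \<nu>\<^sub>0 * ((\<Sum>j<N. W \<nu>\<^sub>0 ^ j) /\<^sub>R real N))) (W1_nhds \<nu>\<^sub>0)"
        by (intro tendsto_norm tendsto_mult tendsto_scaleR tendsto_const tendsto_sum tendsto_power V W)
      from order_tendstoD(2)[OF this, of \<eta>] elim
      have "\<forall>\<^sub>F \<nu> in W1_nhds \<nu>\<^sub>0. norm (V \<nu> * ((\<Sum>j<N. W \<nu> ^ j) /\<^sub>R real N)) < \<eta>" by simp
      with eventually_Prob_c show ?case
      proof eventually_elim
        case (elim \<nu>)
        then show ?case
          by (simp only: avg[OF elim(1)] diff_zero norm_mult group_characterD(3)[OF monomial(1)] mult_1_right) (simp add: norm_mult)
      qed
    qed
    then show ?thesis by blast
  qed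
next
  case (add F G)
  from add.IH obtain zF zG where
    zF: "\<And>\<eta>. \<eta> > 0 \<Longrightarrow> \<forall>\<^sub>F N in sequentially. \<forall>\<^sub>F \<nu> in W1_nhds \<nu>\<^sub>0. \<forall>\<theta>. norm (block_average \<nu> a N F \<theta> - zF) \<le> \<eta>" and
    zG: "\<And>\<eta>. \<eta> > 0 \<Longrightarrow> \<forall>\<^sub>F N in sequentially. \<forall>\<^sub>F \<nu> in W1_nhds \<nu>\<^sub>0. \<forall>\<theta>. norm (block_average \<nu> a N G \<theta> - zG) \<le> \<eta>"
    by blast
  have int: "integrable (iid \<nu>) (\<lambda>x. H (orbit a j (x, \<theta>)))" if \<nu>: "\<nu> \<in> Prob_c" and H: "trig p H" for \<nu> H j \<theta>
  proof -
    obtain B where "\<And>z. norm (H z) \<le> B" using trig_bounded[OF H] by (auto simp: bounded_iff)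
    then show ?thesis
      using Prob_cD(1,2)[OF \<nu>]
      by (intro integrable_iid_section[where \<psi> = "\<lambda>z. H (orbit a j z)" and K = B]
          continuous_on_compose2[OF trig_continuous[OF H] continuous_on_orbit[OF a]]) auto
  qed
  have sum: "block_average \<nu> a N (\<lambda>z. F z + G z) \<theta> = block_average \<nu> a N F \<theta> + block_average \<nu> a N G \<theta>"
    if "\<nu> \<in> Prob_c" for \<nu> N \<theta>
    using int[OF that] add(1,2) by (simp add: block_average_def sum.distrib scaleR_add_right)
  have "\<forall>\<^sub>F N in sequentially. \<forall>\<^sub>F \<nu> in W1_nhds \<nu>\<^sub>0. \<forall>\<theta>. norm (block_average \<nu> a N (\<lambda>z. F z + G z) \<theta> - (zF + zG)) \<le> \<eta>"
    if "\<eta> > 0" for \<eta>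
    using zF[OF half_gt_zero[OF that]] zG[OF half_gt_zero[OF that]]
  proof eventually_elim
    case (elim N)
    from elim eventually_Prob_c show ?case
    proof eventually_elim
      case (elim \<nu>)
      show ?case
      proof
        fix \<theta>
        have "block_average \<nu> a N (\<lambda>z. F z + G z) \<theta> - (zF + zG)
            = (block_average \<nu> a N F \<theta> - zF) + (block_average \<nu> a N G \<theta> - zG)"
          by (simp add: sum[OF elim(3)])
        also have "norm \<dots> \<le> \<eta> / 2 + \<eta> / 2"
          using elim(1,2) by (intro norm_triangle_mono) auto
        finally show "norm (block_average \<nu> a N (\<lambda>z. F z + G z) \<theta> - (zF + zG)) \<le> \<eta>" by simp
      qed
    qed
  qed
  then show ?case by blast
qed

text \<open>The error of a trigonometric approximation is small near the support of \<open>\<nu>\<^sub>0\<close> and bounded elsewhere. Both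
  facts are encoded in one continuous majorant, a constant plus a sum of functions of single entries that
  vanish on the support; its expectation is therefore small for measures near \<open>\<nu>\<^sub>0\<close>.\<close>

lemma block_average_near_constant:
  fixes a :: "'a::{metric_space, second_countable_topology} \<Rightarrow> 't::{topological_ab_group_add, t2_space, second_countable_topology}"
    and \<psi> :: "(nat \<Rightarrow> 'a) \<times> 't \<Rightarrow> real"
  assumes comp: "compact (UNIV :: 't set)"
    and char: "\<And>\<theta> \<theta>' :: 't. \<theta> \<noteq> \<theta>' \<Longrightarrow> \<exists>\<kappa>. group_character \<kappa> \<and> \<kappa> \<theta> \<noteq> \<kappa> \<theta>'"
    and \<nu>\<^sub>0: "\<nu>\<^sub>0 \<in> Prob_c" and a: "continuous_on UNIV a"
    and erg: "\<And>\<kappa> :: 't \<Rightarrow> complex. group_character \<kappa> \<Longrightarrow> \<kappa> \<noteq> (\<lambda>_. 1) \<Longrightarrow> (\<integral>x. \<kappa> (a x) \<partial>\<nu>\<^sub>0) \<noteq> 1"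
    and \<psi>: "continuous_on UNIV \<psi>" "depends_below p \<psi>" "bounded (range \<psi>)" and "\<eta> > 0"
  shows "\<exists>z. \<forall>\<^sub>F N in sequentially. \<forall>\<^sub>F \<nu> in W1_nhds \<nu>\<^sub>0. \<forall>\<theta>. \<bar>block_average \<nu> a N \<psi> \<theta> - z\<bar> \<le> \<eta>"
proof -
  define K where "K = measure_support \<nu>\<^sub>0"
  have K: "compact K" "K \<noteq> {}"
    using Prob_cD(4)[OF \<nu>\<^sub>0] measure_support_nonempty[OF \<nu>\<^sub>0] by (auto simp: K_def)
  obtain G r where G: "trig p G" "r > 0"
    "\<And>x \<theta>. (\<forall>i<p. infdist (x i) K < r) \<Longrightarrow> \<bar>\<psi> (x, \<theta>) - Re (G (x, \<theta>))\<bar> < \<eta> / 4"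
    using trig_approximation[OF comp char K \<psi>(1,2), of "\<eta> / 4"] \<open>\<eta> > 0\<close> by auto
  obtain A where A: "\<And>z. \<bar>\<psi> z\<bar> \<le> A" using \<psi>(3) by (auto simp: bounded_iff)
  obtain B where B: "\<And>z. norm (G z) \<le> B" using trig_bounded[OF G(1)] by (auto simp: bounded_iff)
  define C where "C = A + B"
  have "C \<ge> 0" unfolding C_def
    using A[of undefined] B[of undefined] by (meson abs_ge_zero add_nonneg_nonneg norm_ge_zero order_trans)
  define h where "h = (\<lambda>x. min 1 (infdist x K / r))"
  have h: "continuous_on UNIV h" "bounded (range h)" "\<And>x. 0 \<le> h x"
    unfolding h_def using G(2)
    by (auto intro!: continuous_intros boundedI[where B = 1] simp: infdist_nonneg)
  have pointwise: "\<bar>\<psi> z - Re (G z)\<bar> \<le> \<eta> / 4 + C * (\<Sum>i<p. h (fst z i))" for z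
  proof (cases "\<forall>i<p. infdist (fst z i) K < r")
    case True
    moreover have "0 \<le> C * (\<Sum>i<p. h (fst z i))" using \<open>C \<ge> 0\<close> h(3) by (simp add: sum_nonneg)
    ultimately show ?thesis using G(3)[of "fst z" "snd z"] by simp
  next
    case False
    then obtain i where i: "i < p" "infdist (fst z i) K \<ge> r" by (auto simp: not_less)
    have "1 = h (fst z i)" using i G(2) by (simp add: h_def)
    also have "\<dots> \<le> (\<Sum>i<p. h (fst z i))" using i h(3) by (intro member_le_sum) auto
    finally have "C * 1 \<le> C * (\<Sum>i<p. h (fst z i))" using \<open>C \<ge> 0\<close> by (intro mult_left_mono)
    moreover have "\<bar>\<psi> z - Re (G z)\<bar> \<le> C"
      using A[of z] B[of z] abs_Re_le_cmod[of "G z"] unfolding C_def by linarith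
    ultimately show ?thesis using \<open>\<eta> > 0\<close> by simp
  qed
  have "AE x in \<nu>\<^sub>0. h x = 0"
    using AE_measure_support[OF Prob_cD(2)[OF \<nu>\<^sub>0]] by eventually_elim (simp add: h_def K_def)
  then have "(\<integral>x. h x \<partial>\<nu>\<^sub>0) = 0" by (rule integral_eq_zero_AE)
  then have "((\<lambda>\<nu>. C * p * (\<integral>x. h x \<partial>\<nu>)) \<longlongrightarrow> C * p * 0) (W1_nhds \<nu>\<^sub>0)"
    using tendsto_integral_W1_nhds_real[OF \<nu>\<^sub>0 h(1,2)] by (intro tendsto_mult tendsto_const) simp
  then have ev_h: "\<forall>\<^sub>F \<nu> in W1_nhds \<nu>\<^sub>0. C * p * (\<integral>x. h x \<partial>\<nu>) < \<eta> / 4"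
    using \<open>\<eta> > 0\<close> by (intro order_tendstoD(2)) auto
  have near: "\<bar>(\<integral>x. \<psi> (orbit a j (x, \<theta>)) \<partial>iid \<nu>) - Re (\<integral>x. G (orbit a j (x, \<theta>)) \<partial>iid \<nu>)\<bar> \<le> \<eta> / 2"
    if \<nu>: "\<nu> \<in> Prob_c" and hh: "C * p * (\<integral>x. h x \<partial>\<nu>) < \<eta> / 4" for \<nu> j \<theta>
  proof -
    note P = Prob_cD(1,2)[OF \<nu>]
    interpret n: prob_space \<nu> by (rule P)
    interpret i: prob_space "iid \<nu>" by (rule prob_space_iid[OF P(1)])
    have int_\<psi>: "integrable (iid \<nu>) (\<lambda>x. \<psi> (orbit a j (x, \<theta>)))"
      using A by (intro integrable_iid_section[OF P, where \<psi> = "\<lambda>z. \<psi> (orbit a j z)" and K = A]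
          continuous_on_compose2[OF \<psi>(1) continuous_on_orbit[OF a]]) auto
    have int_G: "integrable (iid \<nu>) (\<lambda>x. G (orbit a j (x, \<theta>)))"
      using B by (intro integrable_iid_section[OF P, where \<psi> = "\<lambda>z. G (orbit a j z)" and K = B]
          continuous_on_compose2[OF trig_continuous[OF G(1)] continuous_on_orbit[OF a]]) auto
    have mh: "h \<in> borel_measurable \<nu>"
      using borel_measurable_continuous_onI[OF h(1)] P(2) by (simp cong: measurable_cong_sets)
    have int_h: "integrable (iid \<nu>) (\<lambda>x. h (x i))" for i
    proof (rule i.integrable_const_bound[where B = 1])
      have "(\<lambda>x. x i) \<in> measurable (iid \<nu>) \<nu>" unfolding iid_def by simp
      then show "(\<lambda>x. h (x i)) \<in> borel_measurable (iid \<nu>)" by (rule measurable_compose[OF _ mh])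
    qed (use h(3) in \<open>simp add: h_def\<close>)
    have "\<bar>(\<integral>x. \<psi> (orbit a j (x, \<theta>)) \<partial>iid \<nu>) - Re (\<integral>x. G (orbit a j (x, \<theta>)) \<partial>iid \<nu>)\<bar>
        = \<bar>\<integral>x. \<psi> (orbit a j (x, \<theta>)) - Re (G (orbit a j (x, \<theta>))) \<partial>iid \<nu>\<bar>"
      using int_\<psi> int_G by simp
    also have "\<dots> \<le> (\<integral>x. \<bar>\<psi> (orbit a j (x, \<theta>)) - Re (G (orbit a j (x, \<theta>)))\<bar> \<partial>iid \<nu>)"
      by (rule integral_abs_bound)
    also have "\<dots> \<le> (\<integral>x. \<eta> / 4 + C * (\<Sum>i<p. h (x (i + j))) \<partial>iid \<nu>)"
    proof (rule integral_mono)
      show "\<bar>\<psi> (orbit a j (x, \<theta>)) - Re (G (orbit a j (x, \<theta>)))\<bar> \<le> \<eta> / 4 + C * (\<Sum>i<p. h (x (i + j)))" for x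
        using pointwise[of "orbit a j (x, \<theta>)"] by (simp add: orbit_def)
    qed (use int_\<psi> int_G int_h in simp_all)
    also have "\<dots> = \<eta> / 4 + C * p * (\<integral>x. h x \<partial>\<nu>)"
      using int_h by (simp add: i.prob_space integral_iid_component[OF P(1) mh])
    finally show ?thesis using hh by simp
  qed
  obtain zG where zG: "\<And>\<eta>. \<eta> > 0 \<Longrightarrow> \<forall>\<^sub>F N in sequentially. \<forall>\<^sub>F \<nu> in W1_nhds \<nu>\<^sub>0. \<forall>\<theta>. norm (block_average \<nu> a N G \<theta> - zG) \<le> \<eta>"
    using trig_block_average[OF \<nu>\<^sub>0 a erg G(1)] by blast
  have "\<forall>\<^sub>F N in sequentially. \<forall>\<^sub>F \<nu> in W1_nhds \<nu>\<^sub>0. \<forall>\<theta>. \<bar>block_average \<nu> a N \<psi> \<theta> - Re zG\<bar> \<le> \<eta>"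
    using zG[OF half_gt_zero[OF \<open>\<eta> > 0\<close>]] eventually_gt_at_top[of 0]
  proof eventually_elim
    case (elim N)
    note N = \<open>0 < N\<close>
    from elim(1) ev_h eventually_Prob_c show ?case
    proof eventually_elim
      case (elim \<nu>)
      show ?case
      proof
        fix \<theta>
        have "block_average \<nu> a N \<psi> \<theta> - Re (block_average \<nu> a N G \<theta>)
          = (\<Sum>j<N. (\<integral>x. \<psi> (orbit a j (x, \<theta>)) \<partial>iid \<nu>) - Re (\<integral>x. G (orbit a j (x, \<theta>)) \<partial>iid \<nu>)) / real N"
          by (simp add: block_average_def sum_subtractf divide_inverse right_diff_distrib mult.commute)
        moreover have "\<bar>\<Sum>j<N. (\<integral>x. \<psi> (orbit a j (x, \<theta>)) \<partial>iid \<nu>) - Re (\<integral>x. G (orbit a j (x, \<theta>)) \<partial>iid \<nu>)\<bar> \<le> (\<Sum>j<N. \<eta> / 2)"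
          by (intro order_trans[OF sum_abs] sum_mono near[OF elim(3,2)])
        ultimately have "\<bar>block_average \<nu> a N \<psi> \<theta> - Re (block_average \<nu> a N G \<theta>)\<bar> \<le> \<eta> / 2"
          using N by (simp add: divide_le_eq mult.commute)
        moreover have "\<bar>Re (block_average \<nu> a N G \<theta>) - Re zG\<bar> \<le> \<eta> / 2"
          using elim(1)[rule_format, of \<theta>] abs_Re_le_cmod[of "block_average \<nu> a N G \<theta> - zG"] by simp
        ultimately show "\<bar>block_average \<nu> a N \<psi> \<theta> - Re zG\<bar> \<le> \<eta>" by linarith
      qed
    qed
  qed
  then show ?thesis by blast
qed

section \<open>Large deviations for two-sided sequences\<close>

lemma distr_bernoulli_reindex:
  assumes "prob_space \<nu>" "inj f"
  shows "distr (bernoulli \<nu>) (Pi\<^sub>M UNIV (\<lambda>_. \<nu>)) (\<lambda>\<omega> n. \<omega> (f n)) = Pi\<^sub>M UNIV (\<lambda>_. \<nu>)"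
  using distr_PiM_reindex[of UNIV "\<lambda>_. \<nu>" f UNIV] assms by (simp add: bernoulli_def restrict_def)

lemma measurable_bernoulli_reindex:
  "(\<lambda>\<omega> n. \<omega> (f n)) \<in> measurable (bernoulli \<nu>) (Pi\<^sub>M UNIV (\<lambda>_. \<nu>))"
  unfolding bernoulli_def by (rule measurable_PiM_single') (auto simp: space_PiM)

lemma skew_funpow:
  "(skew a ^^ j) (\<omega>, \<theta>) = (\<lambda>n. \<omega> (n + int j), \<theta> + (\<Sum>i<j. a (\<omega> (int i))))"
proof (induction j)
  case (Suc j)
  then show ?case by (simp add: skew_def shift_def add_ac)
qed simp

text \<open>The observable after \<open>k\<close> further steps, read as a function of the present angle and the one-sided
  sequence. Indices below \<open>-k\<close> are sent to \<open>0\<close> by \<open>nat\<close>, which is harmless when \<open>\<phi>\<close> depends only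
  on the indices from \<open>-k\<close> to \<open>k\<close>.\<close>

definition one_sided :: "('a \<Rightarrow> 't::ab_group_add) \<Rightarrow> nat \<Rightarrow> ((int \<Rightarrow> 'a) \<times> 't \<Rightarrow> 'b) \<Rightarrow> (nat \<Rightarrow> 'a) \<times> 't \<Rightarrow> 'b"
  where "one_sided a k \<phi> = (\<lambda>z. \<phi> (\<lambda>i. fst z (nat (i + int k)), snd (orbit a k z)))"

lemma continuous_on_one_sided:
  fixes a :: "'a::topological_space \<Rightarrow> 't::topological_ab_group_add"
  assumes "continuous_on UNIV \<phi>" "continuous_on UNIV a"
  shows "continuous_on UNIV (one_sided a k \<phi>)"
proof -
  have "continuous_on UNIV (\<lambda>z :: (nat \<Rightarrow> 'a) \<times> 't. (\<lambda>i :: int. fst z (nat (i + int k))))"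
    by (rule continuous_on_coordinatewise_then_product) (rule continuous_on_fst_component)
  moreover have "continuous_on UNIV (\<lambda>z. snd (orbit a k z))"
    by (intro continuous_on_snd continuous_on_orbit assms)
  ultimately have "continuous_on UNIV (\<lambda>z :: (nat \<Rightarrow> 'a) \<times> 't. (\<lambda>i :: int. fst z (nat (i + int k)), snd (orbit a k z)))"
    by (rule continuous_on_Pair)
  from continuous_on_compose2[OF assms(1) this] show ?thesis by (simp add: one_sided_def)
qed

lemma depends_below_one_sided:
  assumes "\<And>\<omega> \<omega>' \<theta>. (\<And>i. \<bar>i\<bar> \<le> int k \<Longrightarrow> \<omega> i = \<omega>' i) \<Longrightarrow> \<phi> (\<omega>, \<theta>) = \<phi> (\<omega>', \<theta>)"
  shows "depends_below (2 * k + 1) (one_sided a k \<phi>)"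
  unfolding depends_below_def
proof (intro allI impI)
  fix x y :: "nat \<Rightarrow> 'a" and \<theta> assume eq: "\<forall>i<2 * k + 1. x i = y i"
  then have "(\<Sum>i<k. a (x i)) = (\<Sum>i<k. a (y i))" by (intro sum.cong) auto
  moreover have "\<phi> (\<lambda>i. x (nat (i + int k)), \<theta>') = \<phi> (\<lambda>i. y (nat (i + int k)), \<theta>')" for \<theta>'
    using eq by (intro assms) auto
  ultimately show "one_sided a k \<phi> (x, \<theta>) = one_sided a k \<phi> (y, \<theta>)"
    by (simp add: one_sided_def orbit_def)
qed

lemma skew_funpow_one_sided:
  assumes "\<And>\<omega> \<omega>' \<theta>. (\<And>i. \<bar>i\<bar> \<le> int k \<Longrightarrow> \<omega> i = \<omega>' i) \<Longrightarrow> \<phi> (\<omega>, \<theta>) = \<phi> (\<omega>', \<theta>)"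
  shows "\<phi> ((skew a ^^ (j + k)) (\<omega>, \<theta>)) = one_sided a k \<phi> (orbit a j (\<lambda>n. \<omega> (int n), \<theta>))"
proof -
  have "snd (orbit a k (orbit a j (\<lambda>n. \<omega> (int n), \<theta>))) = \<theta> + (\<Sum>i<j + k. a (\<omega> (int i)))"
    unfolding orbit_add[symmetric] by (simp add: orbit_def)
  then have "one_sided a k \<phi> (orbit a j (\<lambda>n. \<omega> (int n), \<theta>))
      = \<phi> (\<lambda>i. \<omega> (int (nat (i + int k) + j)), \<theta> + (\<Sum>i<j + k. a (\<omega> (int i))))"
    by (simp add: one_sided_def orbit_def add.assoc)
  also have "\<dots> = \<phi> (\<lambda>i. \<omega> (i + int (j + k)), \<theta> + (\<Sum>i<j + k. a (\<omega> (int i))))"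
    by (rule assms) (auto simp: add_ac)
  finally show ?thesis by (simp add: skew_funpow)
qed

lemma sum_shift_diff_bound:
  fixes f :: "nat \<Rightarrow> real"
  assumes "\<And>j. \<bar>f j\<bar> \<le> K"
  shows "\<bar>(\<Sum>j<n. f j) - (\<Sum>j<n. f (j + k))\<bar> \<le> 2 * real k * K"
proof -
  have "(\<Sum>j<n. f j) + (\<Sum>j<k. f (n + j)) = (\<Sum>j<k. f j) + (\<Sum>j<n. f (j + k))"
    using sum_lessThan_add[of f n k] sum_lessThan_add[of f k n] by (simp add: add.commute)
  moreover have "\<bar>\<Sum>j<k. f (n + j)\<bar> \<le> real k * K"
    using sum_bounded_above[of "{..<k}" "\<lambda>j. \<bar>f (n + j)\<bar>" K] assms by (intro order_trans[OF sum_abs]) simp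
  moreover have "\<bar>\<Sum>j<k. f j\<bar> \<le> real k * K"
    using sum_bounded_above[of "{..<k}" "\<lambda>j. \<bar>f j\<bar>" K] assms by (intro order_trans[OF sum_abs]) simp
  ultimately show ?thesis by linarith
qed

lemma borel_measurable_bernoulli_haar:
  fixes \<phi> :: "(int \<Rightarrow> 'a::second_countable_topology) \<times> 't::{topological_ab_group_add, second_countable_topology} \<Rightarrow> 'b::topological_space"
  assumes "sets \<nu> = sets borel" "haar_prob m" "continuous_on UNIV \<phi>"
  shows "\<phi> \<in> borel_measurable (bernoulli \<nu> \<Otimes>\<^sub>M m)"
proof -
  have "sets (bernoulli \<nu> \<Otimes>\<^sub>M m) = sets (borel \<Otimes>\<^sub>M borel)"
    by (rule sets_pair_measure_cong[OF sets_bernoulli[OF assms(1)] haar_probD(2)[OF assms(2)]])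
  then have "sets (bernoulli \<nu> \<Otimes>\<^sub>M m) = sets borel" unfolding borel_prod .
  then show ?thesis
    using borel_measurable_continuous_onI[OF assms(3)] by (simp cong: measurable_cong_sets)
qed

text \<open>Invariance of the product measure: for fixed \<open>\<omega>\<close> the translation of the angle disappears in the Haar
  integral, and then for fixed angle the shift disappears in the Bernoulli integral.\<close>

lemma integral_bernoulli_haar_eq_integral_iterate:
  fixes a :: "'a::second_countable_topology \<Rightarrow> circle ^ 'd" and \<phi> :: "(int \<Rightarrow> 'a) \<times> (circle ^ 'd) \<Rightarrow> real"
  assumes \<nu>: "prob_space \<nu>" "sets \<nu> = sets borel" and m: "haar_prob m" and a: "continuous_on UNIV a"
    and \<phi>: "continuous_on UNIV \<phi>" "\<And>z. \<bar>\<phi> z\<bar> \<le> K"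
  shows "(\<integral>z. \<phi> z \<partial>(bernoulli \<nu> \<Otimes>\<^sub>M m)) = (\<integral>\<theta>. (\<integral>\<omega>. \<phi> ((skew a ^^ j) (\<omega>, \<theta>)) \<partial>bernoulli \<nu>) \<partial>m)"
    and "integrable m (\<lambda>\<theta>. \<integral>\<omega>. \<phi> ((skew a ^^ j) (\<omega>, \<theta>)) \<partial>bernoulli \<nu>)"
proof -
  interpret b: prob_space "bernoulli \<nu>" by (rule prob_space_bernoulli) fact
  interpret m: prob_space m by (rule haar_probD(1)[OF m])
  interpret bm: pair_prob_space "bernoulli \<nu>" m ..
  have int: "integrable (bernoulli \<nu> \<Otimes>\<^sub>M m) g" if "continuous_on UNIV g" "\<And>z. \<bar>g z\<bar> \<le> K" for g :: "_ \<Rightarrow> real"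
    using that by (intro bm.integrable_const_bound[where B = K] borel_measurable_bernoulli_haar[OF \<nu>(2) m]) auto
  define s where "s = (\<lambda>\<omega> n. \<omega> (n + int j) :: 'a)"
  define d where "d = (\<lambda>\<omega>. \<Sum>i<j. a (\<omega> (int i)))"
  have c: "continuous_on UNIV (\<lambda>z :: (int \<Rightarrow> 'a) \<times> (circle ^ 'd). s (fst z))"
    unfolding s_def by (rule continuous_on_coordinatewise_then_product) (rule continuous_on_fst_component)
  have cd: "continuous_on UNIV (\<lambda>z :: (int \<Rightarrow> 'a) \<times> (circle ^ 'd). d (fst z))"
    unfolding d_def by (intro continuous_on_sum continuous_on_compose2[OF a continuous_on_fst_component]) auto
  have "continuous_on UNIV (\<lambda>z. \<phi> (s (fst z), snd z + d (fst z)))"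
    by (intro continuous_on_compose2[OF \<phi>(1)] continuous_on_Pair c continuous_on_add cd continuous_on_snd continuous_on_id) auto
  note int_sd = int[OF this \<phi>(2)]
  have "continuous_on UNIV (\<lambda>z :: (int \<Rightarrow> 'a) \<times> (circle ^ 'd). \<phi> (s (fst z), snd z))"
    by (intro continuous_on_compose2[OF \<phi>(1)] continuous_on_Pair c continuous_on_snd continuous_on_id) auto
  note int_s = int[OF this \<phi>(2)]
  have eq: "\<phi> ((skew a ^^ j) (\<omega>, \<theta>)) = \<phi> (s \<omega>, \<theta> + d \<omega>)" for \<omega> \<theta>
    by (simp add: skew_funpow s_def d_def)
  show "integrable m (\<lambda>\<theta>. \<integral>\<omega>. \<phi> ((skew a ^^ j) (\<omega>, \<theta>)) \<partial>bernoulli \<nu>)"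
    unfolding eq using bm.integrable_snd[of "\<lambda>\<omega> \<theta>. \<phi> (s \<omega>, \<theta> + d \<omega>)"] int_sd by (simp add: split_def)
  have mc: "(\<lambda>\<theta>. \<phi> (\<omega>, \<theta>)) \<in> borel_measurable m" for \<omega>
  proof -
    have "continuous_on UNIV (\<lambda>\<theta>. \<phi> (\<omega>, \<theta>))"
      by (intro continuous_on_compose2[OF \<phi>(1)] continuous_intros) auto
    then show ?thesis
      using borel_measurable_continuous_onI haar_probD(2)[OF m] by (simp cong: measurable_cong_sets)
  qed
  have mb: "(\<lambda>\<omega>. \<phi> (\<omega>, \<theta>)) \<in> borel_measurable (bernoulli \<nu>)" for \<theta>
  proof -
    have "continuous_on UNIV (\<lambda>\<omega>. \<phi> (\<omega>, \<theta>))"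
      by (intro continuous_on_compose2[OF \<phi>(1)] continuous_intros) auto
    then show ?thesis
      using borel_measurable_continuous_onI sets_bernoulli[OF \<nu>(2)] by (simp cong: measurable_cong_sets)
  qed
  have "(\<integral>\<theta>. (\<integral>\<omega>. \<phi> ((skew a ^^ j) (\<omega>, \<theta>)) \<partial>bernoulli \<nu>) \<partial>m)
      = (\<integral>\<omega>. (\<integral>\<theta>. \<phi> (s \<omega>, \<theta> + d \<omega>) \<partial>m) \<partial>bernoulli \<nu>)"
    unfolding eq using bm.Fubini_integral[of "\<lambda>\<omega> \<theta>. \<phi> (s \<omega>, \<theta> + d \<omega>)"] int_sd by (simp add: split_def)
  also have "\<dots> = (\<integral>\<omega>. (\<integral>\<theta>. \<phi> (s \<omega>, \<theta>) \<partial>m) \<partial>bernoulli \<nu>)"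
    by (simp add: integral_haar_translate[OF m mc])
  also have "\<dots> = (\<integral>\<theta>. (\<integral>\<omega>. \<phi> (s \<omega>, \<theta>) \<partial>bernoulli \<nu>) \<partial>m)"
    using bm.Fubini_integral[of "\<lambda>\<omega> \<theta>. \<phi> (s \<omega>, \<theta>)"] int_s by (simp add: split_def)
  also have "\<dots> = (\<integral>\<theta>. (\<integral>\<omega>. \<phi> (\<omega>, \<theta>) \<partial>bernoulli \<nu>) \<partial>m)"
  proof (rule Bochner_Integration.integral_cong[OF refl])
    fix \<theta>
    have "bernoulli \<nu> = distr (bernoulli \<nu>) (bernoulli \<nu>) s"
      using distr_bernoulli_reindex[OF \<nu>(1), of "\<lambda>n. n + int j"] unfolding s_def bernoulli_def[of \<nu>] by (simp add: inj_def)
    then have "(\<integral>\<omega>. \<phi> (\<omega>, \<theta>) \<partial>bernoulli \<nu>) = (\<integral>\<omega>. \<phi> (\<omega>, \<theta>) \<partial>distr (bernoulli \<nu>) (bernoulli \<nu>) s)" by simp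
    also have "\<dots> = (\<integral>\<omega>. \<phi> (s \<omega>, \<theta>) \<partial>bernoulli \<nu>)"
      using measurable_bernoulli_reindex[of "\<lambda>n. n + int j" \<nu>]
      by (intro integral_distr mb) (simp add: s_def[abs_def] bernoulli_def)
    finally show "(\<integral>\<omega>. \<phi> (s \<omega>, \<theta>) \<partial>bernoulli \<nu>) = (\<integral>\<omega>. \<phi> (\<omega>, \<theta>) \<partial>bernoulli \<nu>)" ..
  qed
  also have "\<dots> = (\<integral>z. \<phi> z \<partial>(bernoulli \<nu> \<Otimes>\<^sub>M m))"
    using bm.integral_snd[of "\<lambda>\<omega> \<theta>. \<phi> (\<omega>, \<theta>)"] int[OF \<phi>] by (simp add: split_def)
  finally show "(\<integral>z. \<phi> z \<partial>(bernoulli \<nu> \<Otimes>\<^sub>M m)) = (\<integral>\<theta>. (\<integral>\<omega>. \<phi> ((skew a ^^ j) (\<omega>, \<theta>)) \<partial>bernoulli \<nu>) \<partial>m)" ..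
qed

text \<open>The one-sided bound applied to \<open>\<psi> - I\<close> and to \<open>I - \<psi>\<close>, both bounded by \<open>2 * K\<close>.\<close>

lemma measure_large_deviation:
  fixes a :: "'a::second_countable_topology \<Rightarrow> 't::topological_ab_group_add"
    and \<psi> :: "(nat \<Rightarrow> 'a) \<times> 't \<Rightarrow> real"
  assumes \<nu>: "prob_space \<nu>" "sets \<nu> = sets borel" and a: "continuous_on UNIV a"
    and \<psi>: "continuous_on UNIV \<psi>" "depends_below p \<psi>" "\<And>z. \<bar>\<psi> z\<bar> \<le> K" and I: "\<bar>I\<bar> \<le> K"
    and \<epsilon>: "0 < \<epsilon>" "\<epsilon> \<le> K" and N: "0 < N" "16 * K * p \<le> N * \<epsilon>"
    and avg: "\<And>\<theta>. \<bar>block_average \<nu> a N \<psi> \<theta> - I\<bar> \<le> \<epsilon> / 4"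
    and n: "16 * K * (N + p) \<le> n * \<epsilon>"
  shows "measure (iid \<nu>) {x. n * \<epsilon> \<le> \<bar>(\<Sum>j<n. \<psi> (orbit a j (x, \<theta>))) - n * I\<bar>} \<le> 2 * exp (- (\<epsilon>\<^sup>2 / (64 * real N * K\<^sup>2)) * n)"
    and "{x. n * \<epsilon> \<le> \<bar>(\<Sum>j<n. \<psi> (orbit a j (x, \<theta>))) - n * I\<bar>} \<in> sets (iid \<nu>)"
proof -
  interpret prob_space "iid \<nu>" using prob_space_iid[OF \<nu>(1)] .
  have int: "integrable (iid \<nu>) (\<lambda>x. \<psi> (orbit a j (x, \<theta>)))" for j \<theta>
    using \<psi>(3) by (intro integrable_iid_section[OF \<nu>, where \<psi> = "\<lambda>z. \<psi> (orbit a j z)" and K = K]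
        continuous_on_compose2[OF \<psi>(1) continuous_on_orbit[OF a]]) auto
  have mean: "(\<integral>x. (\<Sum>j<N. \<psi> (orbit a j (x, \<theta>))) \<partial>iid \<nu>) = N * block_average \<nu> a N \<psi> \<theta>" for \<theta>
    using int N(1) by (simp add: block_average_def)
  have int_sum: "integrable (iid \<nu>) (\<lambda>x. \<Sum>j<N. \<psi> (orbit a j (x, \<theta>)))" for \<theta>
    using int by simp
  have up: "measure (iid \<nu>) {x. n * \<epsilon> \<le> (\<Sum>j<n. \<psi> (orbit a j (x, \<theta>)) - I)} \<le> exp (- (\<epsilon>\<^sup>2 / (16 * real N * (2 * K)\<^sup>2)) * n)"
  proof (rule large_deviation_upper[OF \<nu> a, where \<psi> = "\<lambda>z. \<psi> z - I" and p = p])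
    show "\<bar>\<psi> z - I\<bar> \<le> 2 * K" for z using \<psi>(3)[of z] I by linarith
    show "(\<integral>x. (\<Sum>j<N. \<psi> (orbit a j (x, \<theta>)) - I) \<partial>iid \<nu>) \<le> N * \<epsilon> / 4" for \<theta>
    proof -
      have "(\<integral>x. (\<Sum>j<N. \<psi> (orbit a j (x, \<theta>)) - I) \<partial>iid \<nu>) = N * (block_average \<nu> a N \<psi> \<theta> - I)"
        using int_sum by (simp add: sum_subtractf mean prob_space right_diff_distrib del: Bochner_Integration.integral_sum)
      also have "\<dots> \<le> N * (\<epsilon> / 4)"
      proof (rule mult_left_mono)
        show "block_average \<nu> a N \<psi> \<theta> - I \<le> \<epsilon> / 4" using avg[of \<theta>] by linarith
      qed simp
      finally show ?thesis by simp
    qed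
  qed (use \<psi> \<epsilon> N n in \<open>auto intro!: continuous_intros simp: depends_below_def\<close>)
  have down: "measure (iid \<nu>) {x. n * \<epsilon> \<le> (\<Sum>j<n. I - \<psi> (orbit a j (x, \<theta>)))} \<le> exp (- (\<epsilon>\<^sup>2 / (16 * real N * (2 * K)\<^sup>2)) * n)"
  proof (rule large_deviation_upper[OF \<nu> a, where \<psi> = "\<lambda>z. I - \<psi> z" and p = p])
    show "\<bar>I - \<psi> z\<bar> \<le> 2 * K" for z using \<psi>(3)[of z] I by linarith
    show "(\<integral>x. (\<Sum>j<N. I - \<psi> (orbit a j (x, \<theta>))) \<partial>iid \<nu>) \<le> N * \<epsilon> / 4" for \<theta>
    proof -
      have "(\<integral>x. (\<Sum>j<N. I - \<psi> (orbit a j (x, \<theta>))) \<partial>iid \<nu>) = N * (I - block_average \<nu> a N \<psi> \<theta>)"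
        using int_sum by (simp add: sum_subtractf mean prob_space right_diff_distrib del: Bochner_Integration.integral_sum)
      also have "\<dots> \<le> N * (\<epsilon> / 4)"
      proof (rule mult_left_mono)
        show "I - block_average \<nu> a N \<psi> \<theta> \<le> \<epsilon> / 4" using avg[of \<theta>] by linarith
      qed simp
      finally show ?thesis by simp
    qed
  qed (use \<psi> \<epsilon> N n in \<open>auto intro!: continuous_intros simp: depends_below_def\<close>)
  have meas [measurable]: "(\<lambda>x. \<psi> (orbit a j (x, \<theta>))) \<in> borel_measurable (iid \<nu>)" for j
    using int by (rule borel_measurable_integrable)
  have sp: "{x. P x} = {x \<in> space (iid \<nu>). P x}" for P by (simp add: space_iid[OF \<nu>(2)])
  have sets: "{x. n * \<epsilon> \<le> (\<Sum>j<n. \<psi> (orbit a j (x, \<theta>)) - I)} \<in> sets (iid \<nu>)"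
    "{x. n * \<epsilon> \<le> (\<Sum>j<n. I - \<psi> (orbit a j (x, \<theta>)))} \<in> sets (iid \<nu>)"
    by (subst sp, measurable)+
  have eq: "{x. n * \<epsilon> \<le> \<bar>(\<Sum>j<n. \<psi> (orbit a j (x, \<theta>))) - n * I\<bar>}
      = {x. n * \<epsilon> \<le> (\<Sum>j<n. \<psi> (orbit a j (x, \<theta>)) - I)} \<union> {x. n * \<epsilon> \<le> (\<Sum>j<n. I - \<psi> (orbit a j (x, \<theta>)))}"
    by (auto simp: sum_subtractf abs_if)
  show "{x. n * \<epsilon> \<le> \<bar>(\<Sum>j<n. \<psi> (orbit a j (x, \<theta>))) - n * I\<bar>} \<in> sets (iid \<nu>)"
    unfolding eq using sets by (rule sets.Un)
  have "16 * real N * (2 * K)\<^sup>2 = 64 * real N * K\<^sup>2" by (simp add: power_mult_distrib)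
  note K2 = this
  show "measure (iid \<nu>) {x. n * \<epsilon> \<le> \<bar>(\<Sum>j<n. \<psi> (orbit a j (x, \<theta>))) - n * I\<bar>} \<le> 2 * exp (- (\<epsilon>\<^sup>2 / (64 * real N * K\<^sup>2)) * n)"
    unfolding eq using measure_Un_le[OF sets] up[unfolded K2] down[unfolded K2] by linarith
qed

text \<open>The block length and the constants are fixed before the measure is chosen. Both space averages lie within
  \<open>\<epsilon> / 16\<close> of the constant \<open>z\<close> near all block averages, so they can be treated alike. Half of the
  tolerance \<open>\<epsilon>\<close> pays for discarding the first \<open>k\<close> steps.\<close>

lemma large_deviation_eventually:
  fixes a :: "'a::polish_space \<Rightarrow> circle ^ 'd"
    and m :: "(circle ^ 'd) measure"
    and \<phi> :: "(int \<Rightarrow> 'a) \<times> (circle ^ 'd) \<Rightarrow> real"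
  assumes a: "continuous_on UNIV a" and m: "haar_prob m" and \<nu>\<^sub>0: "\<nu>\<^sub>0 \<in> Prob_c"
    and erg: "ergodic (bernoulli \<nu>\<^sub>0 \<Otimes>\<^sub>M m) (skew a)"
    and \<phi>: "\<phi> \<in> C_b" "depends_on_finitely_many_coords \<phi>" and \<epsilon>: "\<epsilon> > 0"
  shows "\<exists>n\<^sub>0. \<exists>c>0. \<forall>\<^sub>F \<nu> in W1_nhds \<nu>\<^sub>0. \<forall>I\<in>{\<integral>x. \<phi> x \<partial>(bernoulli \<nu> \<Otimes>\<^sub>M m), \<integral>x. \<phi> x \<partial>(bernoulli \<nu>\<^sub>0 \<Otimes>\<^sub>M m)}.
    \<forall>\<theta>. \<forall>n\<ge>n\<^sub>0. measure (bernoulli \<nu>) {\<omega>. \<bar>birkhoff_average (skew a) \<phi> n (\<omega>, \<theta>) - I\<bar> \<ge> \<epsilon>} < exp (- c * real n)"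
proof -
  have c\<phi>: "continuous_on UNIV \<phi>" using \<phi>(1) by (simp add: C_b_def)
  obtain K0 where K0: "\<And>z. \<bar>\<phi> z\<bar> \<le> K0" using \<phi>(1) by (auto simp: C_b_def bounded_iff)
  define K where "K = max K0 \<epsilon>"
  have K: "\<bar>\<phi> z\<bar> \<le> K" "\<epsilon> \<le> K" "K > 0" for z
    using K0[of z] \<epsilon> by (auto simp: K_def)
  obtain J where J: "finite J" "\<And>\<omega> \<omega>' \<theta>. (\<forall>i\<in>J. \<omega> i = \<omega>' i) \<Longrightarrow> \<phi> (\<omega>, \<theta>) = \<phi> (\<omega>', \<theta>)"
    using \<phi>(2) unfolding depends_on_finitely_many_coords_def by metis
  define k where "k = (\<Sum>i\<in>J. nat \<bar>i\<bar>)"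
  have Jk: "\<bar>i\<bar> \<le> int k" if "i \<in> J" for i
  proof -
    have "nat \<bar>i\<bar> \<le> k" unfolding k_def using that J(1) by (intro member_le_sum) auto
    then show ?thesis by linarith
  qed
  have dep: "\<phi> (\<omega>, \<theta>) = \<phi> (\<omega>', \<theta>)" if "\<And>i. \<bar>i\<bar> \<le> int k \<Longrightarrow> \<omega> i = \<omega>' i" for \<omega> \<omega>' \<theta>
    using J(2) that Jk by blast
  define p where "p = 2 * k + 1"
  define \<psi> where "\<psi> = one_sided a k \<phi>"
  have \<psi>: "continuous_on UNIV \<psi>" "depends_below p \<psi>" "\<And>z. \<bar>\<psi> z\<bar> \<le> K"
  proof -
    show "continuous_on UNIV \<psi>" unfolding \<psi>_def by (rule continuous_on_one_sided[OF c\<phi> a])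
    show "depends_below p \<psi>" unfolding \<psi>_def p_def by (rule depends_below_one_sided) (rule dep)
    show "\<bar>\<psi> z\<bar> \<le> K" for z by (simp add: \<psi>_def one_sided_def K)
  qed
  have b\<psi>: "bounded (range \<psi>)" using \<psi>(3) by (auto simp: bounded_iff)
  have iter: "\<phi> ((skew a ^^ (j + k)) (\<omega>, \<theta>)) = \<psi> (orbit a j (\<lambda>n. \<omega> (int n), \<theta>))" for j \<omega> \<theta>
    unfolding \<psi>_def by (rule skew_funpow_one_sided) (rule dep)
  \<comment> \<open>The other half of the tolerance is left for the one-sided Birkhoff sums.\<close>
  define \<epsilon>' where "\<epsilon>' = \<epsilon> / 2"
  have \<epsilon>': "\<epsilon>' > 0" "\<epsilon>' \<le> K" using \<epsilon> K(2) by (auto simp: \<epsilon>'_def)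
  obtain z where z: "\<forall>\<^sub>F N in sequentially. \<forall>\<^sub>F \<nu> in W1_nhds \<nu>\<^sub>0. \<forall>\<theta>. \<bar>block_average \<nu> a N \<psi> \<theta> - z\<bar> \<le> \<epsilon>' / 8"
    using block_average_near_constant[OF compact_vec_UNIV[OF compact_circle] _ \<nu>\<^sub>0 a
        ergodic_imp_integral_character_neq_1[OF a m Prob_cD(1,2)[OF \<nu>\<^sub>0] erg] \<psi>(1,2) b\<psi>, of "\<epsilon>' / 8"]
      torus_characters_separate \<epsilon>' by (metis zero_less_divide_iff zero_less_numeral)
  have "\<forall>\<^sub>F N in sequentially. 16 * K * p / \<epsilon>' \<le> real N"
    using filterlim_real_sequentially by (simp add: filterlim_at_top)
  then have "\<forall>\<^sub>F N in sequentially. (\<forall>\<^sub>F \<nu> in W1_nhds \<nu>\<^sub>0. \<forall>\<theta>. \<bar>block_average \<nu> a N \<psi> \<theta> - z\<bar> \<le> \<epsilon>' / 8)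
      \<and> 16 * K * p / \<epsilon>' \<le> real N \<and> 0 < N"
    using z eventually_gt_at_top[of 0] by eventually_elim simp
  then obtain N where N: "\<forall>\<^sub>F \<nu> in W1_nhds \<nu>\<^sub>0. \<forall>\<theta>. \<bar>block_average \<nu> a N \<psi> \<theta> - z\<bar> \<le> \<epsilon>' / 8"
      "16 * K * p / \<epsilon>' \<le> real N" "0 < N"
    using eventually_happens'[OF sequentially_bot] by blast
  have N2: "16 * K * p \<le> N * \<epsilon>'" using N(2) \<epsilon>' by (simp add: divide_le_eq)
  define c0 where "c0 = \<epsilon>'\<^sup>2 / (64 * real N * K\<^sup>2)"
  have "c0 > 0" using \<epsilon>' N(3) K(3) by (simp add: c0_def)
  obtain n0 :: nat where n0: "16 * K * (N + p) / \<epsilon>' + 2 * k * K / \<epsilon>' + 2 * ln 2 / c0 + 1 \<le> n0"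
    using real_arch_simple by blast
  have to_iid: "(\<integral>\<omega>. \<phi> ((skew a ^^ (j + k)) (\<omega>, \<theta>)) \<partial>bernoulli \<nu>) = (\<integral>x. \<psi> (orbit a j (x, \<theta>)) \<partial>iid \<nu>)"
    if \<nu>: "\<nu> \<in> Prob_c" for \<nu> j \<theta>
  proof -
    have "iid \<nu> = distr (bernoulli \<nu>) (iid \<nu>) (\<lambda>\<omega> n. \<omega> (int n))"
      unfolding iid_def using distr_bernoulli_reindex[OF Prob_cD(1)[OF \<nu>], of int] by simp
    then have "(\<integral>x. \<psi> (orbit a j (x, \<theta>)) \<partial>iid \<nu>) = (\<integral>x. \<psi> (orbit a j (x, \<theta>)) \<partial>distr (bernoulli \<nu>) (iid \<nu>) (\<lambda>\<omega> n. \<omega> (int n)))"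
      by simp
    also have "\<dots> = (\<integral>\<omega>. \<psi> (orbit a j (\<lambda>n. \<omega> (int n), \<theta>)) \<partial>bernoulli \<nu>)"
    proof (rule integral_distr)
      show "(\<lambda>\<omega> n. \<omega> (int n)) \<in> measurable (bernoulli \<nu>) (iid \<nu>)"
        unfolding iid_def by (rule measurable_bernoulli_reindex)
      show "(\<lambda>x. \<psi> (orbit a j (x, \<theta>))) \<in> borel_measurable (iid \<nu>)"
        by (intro measurable_iid_section[OF Prob_cD(2)[OF \<nu>], where \<psi> = "\<lambda>z. \<psi> (orbit a j z)"]
            continuous_on_compose2[OF \<psi>(1) continuous_on_orbit[OF a]]) auto
    qed
    finally show ?thesis by (simp add: iter)
  qed
  have mean: "\<bar>(\<integral>x. \<phi> x \<partial>(bernoulli \<nu> \<Otimes>\<^sub>M m)) - z\<bar> \<le> \<epsilon>' / 8"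
    if \<nu>: "\<nu> \<in> Prob_c" and avg: "\<forall>\<theta>. \<bar>block_average \<nu> a N \<psi> \<theta> - z\<bar> \<le> \<epsilon>' / 8" for \<nu>
  proof -
    interpret m: prob_space m by (rule haar_probD(1)[OF m])
    define I where "I = (\<integral>x. \<phi> x \<partial>(bernoulli \<nu> \<Otimes>\<^sub>M m))"
    have inv: "I = (\<integral>\<theta>. (\<integral>x. \<psi> (orbit a j (x, \<theta>)) \<partial>iid \<nu>) \<partial>m)"
      "integrable m (\<lambda>\<theta>. \<integral>x. \<psi> (orbit a j (x, \<theta>)) \<partial>iid \<nu>)" for j
      using integral_bernoulli_haar_eq_integral_iterate[OF Prob_cD(1,2)[OF \<nu>] m a c\<phi> K(1), where j = "j + k"]
      unfolding to_iid[OF \<nu>] I_def by blast+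
    have int: "integrable m (\<lambda>\<theta>. block_average \<nu> a N \<psi> \<theta>)"
      unfolding block_average_def by (intro integrable_scaleR_right Bochner_Integration.integrable_sum inv(2))
    have "(\<integral>\<theta>. block_average \<nu> a N \<psi> \<theta> \<partial>m) = (\<Sum>j<N. I) /\<^sub>R real N"
      unfolding block_average_def using inv(2) by (simp add: inv(1)[symmetric])
    also have "\<dots> = I" using N(3) by simp
    finally have "I - z = (\<integral>\<theta>. block_average \<nu> a N \<psi> \<theta> - z \<partial>m)"
      using int by (simp add: m.prob_space)
    also have "\<bar>\<dots>\<bar> \<le> (\<integral>\<theta>. \<bar>block_average \<nu> a N \<psi> \<theta> - z\<bar> \<partial>m)" by (rule integral_abs_bound)
    also have "\<dots> \<le> (\<integral>\<theta>. \<epsilon>' / 8 \<partial>m)"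
      using avg int by (intro integral_mono) auto
    finally show ?thesis by (simp add: I_def m.prob_space)
  qed
  have mean0: "\<bar>(\<integral>x. \<phi> x \<partial>(bernoulli \<nu>\<^sub>0 \<Otimes>\<^sub>M m)) - z\<bar> \<le> \<epsilon>' / 8"
    by (rule mean[OF \<nu>\<^sub>0 eventually_W1_nhds_self[OF N(1) \<nu>\<^sub>0]])
  have IK: "\<bar>\<integral>x. \<phi> x \<partial>(bernoulli \<nu> \<Otimes>\<^sub>M m)\<bar> \<le> K" if \<nu>: "\<nu> \<in> Prob_c" for \<nu>
  proof -
    interpret b: prob_space "bernoulli \<nu>" by (rule prob_space_bernoulli[OF Prob_cD(1)[OF \<nu>]])
    interpret m: prob_space m by (rule haar_probD(1)[OF m])
    interpret bm: pair_prob_space "bernoulli \<nu>" m ..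
    have "integrable (bernoulli \<nu> \<Otimes>\<^sub>M m) \<phi>"
      using K(1) by (intro bm.integrable_const_bound[where B = K] borel_measurable_bernoulli_haar[OF Prob_cD(2)[OF \<nu>] m c\<phi>]) auto
    then have "(\<integral>x. \<bar>\<phi> x\<bar> \<partial>(bernoulli \<nu> \<Otimes>\<^sub>M m)) \<le> (\<integral>x. K \<partial>(bernoulli \<nu> \<Otimes>\<^sub>M m))"
      using K(1) by (intro integral_mono) auto
    also have "\<dots> = K" by (simp add: bm.P.prob_space)
    finally show ?thesis by (rule order_trans[OF integral_abs_bound])
  qed
  have bound: "measure (bernoulli \<nu>) {\<omega>. \<bar>birkhoff_average (skew a) \<phi> n (\<omega>, \<theta>) - I\<bar> \<ge> \<epsilon>} < exp (- (c0 / 2) * real n)"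
    if \<nu>: "\<nu> \<in> Prob_c" and avg: "\<And>\<theta>. \<bar>block_average \<nu> a N \<psi> \<theta> - z\<bar> \<le> \<epsilon>' / 8"
      and I: "\<bar>I - z\<bar> \<le> \<epsilon>' / 8" "\<bar>I\<bar> \<le> K" and n: "n \<ge> n0" for \<nu> I \<theta> n
  proof -
    interpret b: prob_space "bernoulli \<nu>" by (rule prob_space_bernoulli[OF Prob_cD(1)[OF \<nu>]])
    have pos: "16 * K * (N + p) / \<epsilon>' \<ge> 0" "2 * k * K / \<epsilon>' \<ge> 0" "2 * ln 2 / c0 \<ge> 0"
      using K(3) \<epsilon>' \<open>c0 > 0\<close> by auto
    have "real n0 \<le> real n" using n by simp
    then have nn: "16 * K * (N + p) / \<epsilon>' \<le> n" "2 * k * K / \<epsilon>' \<le> n" "2 * ln 2 / c0 < n" "0 < n"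
      using n0 pos by linarith+
    have n1: "16 * K * (N + p) \<le> n * \<epsilon>'" using nn(1) \<epsilon>' by (simp add: divide_le_eq)
    have n2: "2 * k * K \<le> n * \<epsilon>'" using nn(2) \<epsilon>' by (simp add: divide_le_eq)
    have n3: "ln 2 < c0 / 2 * n" using nn(3) \<open>c0 > 0\<close> by (simp add: divide_less_eq mult.commute)
    have avgI: "\<bar>block_average \<nu> a N \<psi> \<theta> - I\<bar> \<le> \<epsilon>' / 4" for \<theta>
      using avg[of \<theta>] I(1) by linarith
    define D where "D = {x. n * \<epsilon>' \<le> \<bar>(\<Sum>j<n. \<psi> (orbit a j (x, \<theta>))) - n * I\<bar>}"
    note LD = measure_large_deviation[OF Prob_cD(1,2)[OF \<nu>] a \<psi> I(2) \<epsilon>' N(3) N2 avgI n1, of \<theta>, folded D_def c0_def]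
    have proj: "(\<lambda>\<omega> n. \<omega> (int n)) \<in> measurable (bernoulli \<nu>) (iid \<nu>)"
      unfolding iid_def by (rule measurable_bernoulli_reindex)
    have "measure (bernoulli \<nu>) {\<omega>. \<bar>birkhoff_average (skew a) \<phi> n (\<omega>, \<theta>) - I\<bar> \<ge> \<epsilon>}
        \<le> measure (bernoulli \<nu>) ((\<lambda>\<omega> n. \<omega> (int n)) -` D \<inter> space (bernoulli \<nu>))"
    proof (rule b.finite_measure_mono[OF subsetI measurable_sets[OF proj LD(2)]])
      fix \<omega> assume "\<omega> \<in> {\<omega>. \<bar>birkhoff_average (skew a) \<phi> n (\<omega>, \<theta>) - I\<bar> \<ge> \<epsilon>}"
      then have "\<epsilon> \<le> \<bar>(1 / n) * (\<Sum>j<n. \<phi> ((skew a ^^ j) (\<omega>, \<theta>))) - I\<bar>"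
        by (simp add: birkhoff_average_def)
      then have "n * \<epsilon> \<le> n * \<bar>(1 / n) * (\<Sum>j<n. \<phi> ((skew a ^^ j) (\<omega>, \<theta>))) - I\<bar>"
        by (intro mult_left_mono) auto
      also have "\<dots> = \<bar>n * ((1 / n) * (\<Sum>j<n. \<phi> ((skew a ^^ j) (\<omega>, \<theta>))) - I)\<bar>"
        by (simp add: abs_mult)
      also have "n * ((1 / n) * (\<Sum>j<n. \<phi> ((skew a ^^ j) (\<omega>, \<theta>))) - I) = (\<Sum>j<n. \<phi> ((skew a ^^ j) (\<omega>, \<theta>))) - n * I"
        using nn(4) by (simp add: right_diff_distrib)
      finally have "n * \<epsilon> \<le> \<bar>(\<Sum>j<n. \<phi> ((skew a ^^ j) (\<omega>, \<theta>))) - n * I\<bar>" .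
      moreover have "\<bar>(\<Sum>j<n. \<phi> ((skew a ^^ j) (\<omega>, \<theta>))) - (\<Sum>j<n. \<psi> (orbit a j (\<lambda>n. \<omega> (int n), \<theta>)))\<bar> \<le> 2 * real k * K"
        using sum_shift_diff_bound[of "\<lambda>j. \<phi> ((skew a ^^ j) (\<omega>, \<theta>))" K n k] K(1) by (simp add: iter)
      moreover have "n * \<epsilon> = n * \<epsilon>' + n * \<epsilon>'" by (simp add: \<epsilon>'_def)
      ultimately have "n * \<epsilon>' \<le> \<bar>(\<Sum>j<n. \<psi> (orbit a j (\<lambda>n. \<omega> (int n), \<theta>))) - n * I\<bar>"
        using n2 by linarith
      then show "\<omega> \<in> (\<lambda>\<omega> n. \<omega> (int n)) -` D \<inter> space (bernoulli \<nu>)"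
        by (simp add: D_def space_bernoulli[OF Prob_cD(2)[OF \<nu>]])
    qed
    also have "\<dots> = measure (distr (bernoulli \<nu>) (iid \<nu>) (\<lambda>\<omega> n. \<omega> (int n))) D"
      by (rule measure_distr[OF proj LD(2), symmetric])
    also have "distr (bernoulli \<nu>) (iid \<nu>) (\<lambda>\<omega> n. \<omega> (int n)) = iid \<nu>"
      unfolding iid_def using distr_bernoulli_reindex[OF Prob_cD(1)[OF \<nu>], of int] by simp
    also note LD(1)
    also have "2 * exp (- c0 * n) < exp (- (c0 / 2) * n)"
    proof -
      have "2 * exp (- c0 * n) = exp (ln 2 - c0 * n)" by (simp add: exp_diff exp_minus divide_inverse)
      also have "\<dots> < exp (- (c0 / 2) * n)" using n3 by (simp add: field_simps)
      finally show ?thesis .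
    qed
    finally show ?thesis .
  qed
  have "\<forall>\<^sub>F \<nu> in W1_nhds \<nu>\<^sub>0. \<forall>I\<in>{\<integral>x. \<phi> x \<partial>(bernoulli \<nu> \<Otimes>\<^sub>M m), \<integral>x. \<phi> x \<partial>(bernoulli \<nu>\<^sub>0 \<Otimes>\<^sub>M m)}.
    \<forall>\<theta>. \<forall>n\<ge>n0. measure (bernoulli \<nu>) {\<omega>. \<bar>birkhoff_average (skew a) \<phi> n (\<omega>, \<theta>) - I\<bar> \<ge> \<epsilon>} < exp (- (c0 / 2) * real n)"
    using N(1) eventually_Prob_c
  proof eventually_elim
    case (elim \<nu>)
    show ?case
    proof (intro ballI allI impI)
      fix I \<theta> n
      assume I: "I \<in> {\<integral>x. \<phi> x \<partial>(bernoulli \<nu> \<Otimes>\<^sub>M m), \<integral>x. \<phi> x \<partial>(bernoulli \<nu>\<^sub>0 \<Otimes>\<^sub>M m)}" and n: "n0 \<le> n"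
      have "\<bar>I - z\<bar> \<le> \<epsilon>' / 8" "\<bar>I\<bar> \<le> K"
        using I mean[OF elim(2,1)] mean0 IK[OF elim(2)] IK[OF \<nu>\<^sub>0] by auto
      then show "measure (bernoulli \<nu>) {\<omega>. \<bar>birkhoff_average (skew a) \<phi> n (\<omega>, \<theta>) - I\<bar> \<ge> \<epsilon>} < exp (- (c0 / 2) * real n)"
        using elim(1) by (intro bound[OF elim(2)] n) auto
    qed
  qed
  moreover have "c0 / 2 > 0" using \<open>c0 > 0\<close> by simp
  ultimately show ?thesis by blast
qed

theorem theorem2p4:
  fixes \<aa> :: "'a :: polish_space \<Rightarrow> circle ^ 'd"
    and m :: "(circle ^ 'd) measure"
    and \<nu>\<^sub>0 :: "'a measure"
    and \<phi> :: "(int \<Rightarrow> 'a) \<times> (circle ^ 'd) \<Rightarrow> real"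
  assumes "continuous_on UNIV \<aa>"
    and "haar_prob m"
    and "\<nu>\<^sub>0 \<in> Prob_c"
    and "ergodic (bernoulli \<nu>\<^sub>0 \<Otimes>\<^sub>M m) (skew \<aa>)"
    and "\<phi> \<in> C_b"
    and "depends_on_finitely_many_coords \<phi>"
  shows
    "(\<forall>\<epsilon>>0. \<exists>\<delta>>0. \<exists>n\<^sub>0::nat. \<exists>c>0.
        \<forall>\<nu>\<in>Prob_c. W1 \<nu> \<nu>\<^sub>0 < \<delta> \<longrightarrow> (\<forall>\<theta>. \<forall>n\<ge>n\<^sub>0.
          measure (bernoulli \<nu>)
            {\<omega>. \<bar>birkhoff_average (skew \<aa>) \<phi> n (\<omega>, \<theta>)
                  - (\<integral>x. \<phi> x \<partial>(bernoulli \<nu> \<Otimes>\<^sub>M m))\<bar> \<ge> \<epsilon>}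
          < exp (- c * real n)))
     \<and>
     (\<forall>\<epsilon>>0. \<exists>\<delta>>0. \<exists>n\<^sub>0::nat. \<exists>c>0.
        \<forall>\<nu>\<in>Prob_c. W1 \<nu> \<nu>\<^sub>0 < \<delta> \<longrightarrow> (\<forall>\<theta>. \<forall>n\<ge>n\<^sub>0.
          measure (bernoulli \<nu>)
            {\<omega>. \<bar>birkhoff_average (skew \<aa>) \<phi> n (\<omega>, \<theta>)
                  - (\<integral>x. \<phi> x \<partial>(bernoulli \<nu>\<^sub>0 \<Otimes>\<^sub>M m))\<bar> \<ge> \<epsilon>}
          < exp (- c * real n)))"
proof (intro conjI allI impI)
  fix \<epsilon> :: real assume "\<epsilon> > 0"
  from large_deviation_eventually[OF assms this] obtain n\<^sub>0 c \<delta> where *: "c > 0" "\<delta> > 0"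
    "\<forall>\<nu>\<in>Prob_c. W1 \<nu> \<nu>\<^sub>0 < \<delta> \<longrightarrow> (\<forall>I\<in>{\<integral>x. \<phi> x \<partial>(bernoulli \<nu> \<Otimes>\<^sub>M m), \<integral>x. \<phi> x \<partial>(bernoulli \<nu>\<^sub>0 \<Otimes>\<^sub>M m)}.
      \<forall>\<theta>. \<forall>n\<ge>n\<^sub>0. measure (bernoulli \<nu>) {\<omega>. \<bar>birkhoff_average (skew \<aa>) \<phi> n (\<omega>, \<theta>) - I\<bar> \<ge> \<epsilon>} < exp (- c * real n))"
    unfolding eventually_W1_nhds by blast
  note * = *(1,2) *(3)[rule_format]
  show "\<exists>\<delta>>0. \<exists>n\<^sub>0::nat. \<exists>c>0. \<forall>\<nu>\<in>Prob_c. W1 \<nu> \<nu>\<^sub>0 < \<delta> \<longrightarrow> (\<forall>\<theta>. \<forall>n\<ge>n\<^sub>0.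
      measure (bernoulli \<nu>) {\<omega>. \<bar>birkhoff_average (skew \<aa>) \<phi> n (\<omega>, \<theta>)
        - (\<integral>x. \<phi> x \<partial>(bernoulli \<nu> \<Otimes>\<^sub>M m))\<bar> \<ge> \<epsilon>} < exp (- c * real n))"
    by (intro exI[of _ \<delta>] exI[of _ n\<^sub>0] exI[of _ c] conjI ballI impI allI *) auto
  show "\<exists>\<delta>>0. \<exists>n\<^sub>0::nat. \<exists>c>0. \<forall>\<nu>\<in>Prob_c. W1 \<nu> \<nu>\<^sub>0 < \<delta> \<longrightarrow> (\<forall>\<theta>. \<forall>n\<ge>n\<^sub>0.
      measure (bernoulli \<nu>) {\<omega>. \<bar>birkhoff_average (skew \<aa>) \<phi> n (\<omega>, \<theta>)
        - (\<integral>x. \<phi> x \<partial>(bernoulli \<nu>\<^sub>0 \<Otimes>\<^sub>M m))\<bar> \<ge> \<epsilon>} < exp (- c * real n))"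
    by (intro exI[of _ \<delta>] exI[of _ n\<^sub>0] exI[of _ c] conjI ballI impI allI *) auto
qed

end
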